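(* Let $\varphi_1,\varphi_2\in L^2(\mathbb{R}^d)$, let $T\in B(L^2(\mathbb{R}^d))$ and let $f\in L^p(\mathbb{R}^{2d})$ for some $1\le p\le\infty$. Then the localization operator with symbol $f$ and windows $\varphi_1,\varphi_2$ is given by $$\mathcal{A}_f^{\varphi_1,\varphi_2}=f\ast(\varphi_2\otimes\varphi_1),$$ and the Berezin transform of $T$ with windows $\varphi_1,\varphi_2$ is given by $$\mathcal{B}^{\varphi_1,\varphi_2}T(z)=\big(T\ast(\check\varphi_1\otimes\check\varphi_2)\big)(z)\qquad\text{for all } z\in\mathbb{R}^{2d}.$$
   Context: Inner products and duality brackets are linear in the first and antilinear in the second argument. For $z=(x,\omega)\in\mathbb{R}^{2d}$, $\pi(z)\psi(t)=e^{2\pi i\omega\cdot t}\psi(t-x)$ on $L^2(\mathbb{R}^d)$; $V_\phi\psi(z)=\langle\psi,\pi(z)\phi\rangle$. For $\xi,\eta\in L^2(\mathbb{R}^d)$, $\xi\otimes\eta$ is the rank-one operator $\zeta\mapsto\langle\zeta,\eta\rangle\xi$. Put $\check\psi(x)=P\psi(x)=\psi(-x)$, and for a bounded operator $A$ put $\check A=PAP$ and $\alpha_z(A)=\pi(z)A\pi(z)^*$. $\mathcal{T}^1$ denotes the trace class operators on $L^2(\mathbb{R}^d)$. Localization operator: $\mathcal{A}_f^{\varphi_1,\varphi_2}\psi=\int_{\mathbb{R}^{2d}} f(z)V_{\varphi_1}\psi(z)\,\pi(z)\varphi_2\,dz$, interpreted weakly, i.e. $\langle\mathcal{A}_f^{\varphi_1,\varphi_2}\psi,\phi\rangle=\int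 f(z)V_{\varphi_1}\psi(z)\overline{V_{\varphi_2}\phi(z)}\,dz$ for $\psi,\phi\in L^2(\mathbb{R}^d)$. Berezin transform: $\mathcal{B}^{\varphi_1,\varphi_2}T(z)=\langle T\pi(z)\varphi_1,\pi(z)\varphi_2\rangle$. Operator-operator convolution: for $A\in B(L^2(\mathbb{R}^d))$ and $S\in\mathcal{T}^1$, $A\ast S$ is the function $A\ast S(z)=\mathrm{tr}(A\,\alpha_z(\check S))$ on $\mathbb{R}^{2d}$. Function-operator convolution, for $S\in\mathcal{T}^1$: if $f\in L^1(\mathbb{R}^{2d})$, $f\ast S=\int_{\mathbb{R}^{2d}} f(z)\alpha_z(S)\,dz$ (applied to each vector $\psi$ and taken as a weak vector-valued integral in $L^2(\mathbb{R}^d)$). If $f\in L^\infty(\mathbb{R}^{2d})$, $f\ast S\in B(L^2(\mathbb{R}^d))$ is defined by duality: $\mathrm{tr}((f\ast S)R^* )=\int f(z)\overline{(R\ast\check S^* )(z)}\,dz$ for all $R\in\mathcal{T}^1$. If $f\in L^p$, write $f=f_1+f_\infty$ with $f_1\in L^1$, $f_\infty\in L^\infty$ and set $f\ast S=f_1\ast S+f_\infty\ast S$ (independent of the decomposition). *)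

theory Defs
  imports "HOL-Analysis.Analysis"
begin

section \<open>The Hilbert space of square integrable functions\<close>

definition square_integrable :: "('a::euclidean_space \<Rightarrow> complex) \<Rightarrow> bool" where
  "square_integrable f \<longleftrightarrow>
     f \<in> borel_measurable lborel \<and> integrable lborel (\<lambda>x. (norm (f x))\<^sup>2)"

definition l2_rel :: "('a::euclidean_space \<Rightarrow> complex) \<Rightarrow> ('a \<Rightarrow> complex) \<Rightarrow> bool" where
  "l2_rel f g \<longleftrightarrow> square_integrable f \<and> square_integrable g \<and> (AE x in lborel. f x = g x)"

lemma square_integrable_zero: "square_integrable (\<lambda>x. 0)"
  by (simp add: square_integrable_def)

lemma square_integrable_scale:
  assumes "square_integrable f"
  shows "square_integrable (\<lambda>x. c * f x)"
  using assms by (auto simp: square_integrable_def norm_mult power_mult_distrib)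

lemma square_integrable_add:
  assumes "square_integrable f" "square_integrable g"
  shows "square_integrable (\<lambda>x. f x + g x)"
proof -
  have [measurable]: "f \<in> borel_measurable lborel" "g \<in> borel_measurable lborel"
    using assms by (auto simp: square_integrable_def)
  have *: "(norm (a + b))\<^sup>2 \<le> 2 * (norm a)\<^sup>2 + 2 * (norm b)\<^sup>2" for a b :: complex
  proof -
    have "(norm (a + b))\<^sup>2 \<le> (norm a + norm b)\<^sup>2"
      by (intro power_mono norm_triangle_ineq) auto
    also have "\<dots> \<le> 2 * (norm a)\<^sup>2 + 2 * (norm b)\<^sup>2"
      using sum_squares_ge_zero[of "norm a - norm b" 0]
      by (simp add: power2_eq_square algebra_simps)
    finally show ?thesis .
  qed
  have "integrable lborel (\<lambda>x. 2 * (norm (f x))\<^sup>2 + 2 * (norm (g x))\<^sup>2)"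
    using assms by (auto simp: square_integrable_def)
  then have "integrable lborel (\<lambda>x. (norm (f x + g x))\<^sup>2)"
    by (rule Bochner_Integration.integrable_bound) (use * in auto)
  then show ?thesis by (simp add: square_integrable_def)
qed

lemma borel_measurable_cnj [measurable]:
  "f \<in> borel_measurable M \<Longrightarrow> (\<lambda>x. cnj (f x)) \<in> borel_measurable M"
  by (rule borel_measurable_continuous_on[of cnj]) (intro continuous_intros)+

lemma square_integrable_mult_integrable:
  assumes "square_integrable f" "square_integrable g"
  shows "integrable lborel (\<lambda>x. f x * cnj (g x))"
proof -
  have [measurable]: "f \<in> borel_measurable lborel" "g \<in> borel_measurable lborel"
    using assms by (auto simp: square_integrable_def)
  have *: "norm (a * cnj b) \<le> (norm a)\<^sup>2 + (norm b)\<^sup>2" for a b :: complex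
  proof -
    have "2 * (norm a * norm b) \<le> (norm a)\<^sup>2 + (norm b)\<^sup>2"
      using sum_squares_ge_zero[of "norm a - norm b" 0]
      by (simp add: power2_eq_square algebra_simps)
    moreover have "0 \<le> norm a * norm b" by simp
    ultimately have "norm a * norm b \<le> (norm a)\<^sup>2 + (norm b)\<^sup>2" by linarith
    then show ?thesis by (simp add: norm_mult)
  qed
  have "integrable lborel (\<lambda>x. (norm (f x))\<^sup>2 + (norm (g x))\<^sup>2)"
    using assms by (auto simp: square_integrable_def)
  then show ?thesis
    by (rule Bochner_Integration.integrable_bound) (use * in auto)
qed

lemma square_integrable_translate:
  assumes "square_integrable f"
  shows "square_integrable (\<lambda>t. f (t - a))"
proof -
  have [measurable]: "f \<in> borel_measurable borel"
    using assms by (auto simp: square_integrable_def)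
  have "integrable (distr lborel borel ((+) (- a))) (\<lambda>x. (norm (f x))\<^sup>2)"
    using assms by (auto simp: square_integrable_def lborel_distr_plus)
  then have "integrable lborel (\<lambda>x. (norm (f (- a + x)))\<^sup>2)"
    by (subst (asm) integrable_distr_eq) auto
  then show ?thesis
    by (simp add: square_integrable_def)
qed

lemma AE_lborel_translate:
  fixes a :: "'a::euclidean_space"
  assumes "AE x in lborel. f x = (g x :: complex)"
    and [measurable]: "f \<in> borel_measurable borel" "g \<in> borel_measurable borel"
  shows "AE x in lborel. f (x - a) = g (x - a)"
proof -
  have "AE x in distr lborel borel ((+) (- a)). f x = g x"
    using assms(1) unfolding lborel_distr_plus .
  then show ?thesis
    by (subst (asm) AE_distr_iff) auto
qed

lemma lborel_distr_reflect:
  "distr lborel borel (\<lambda>x. - x) = (lborel :: 'a::euclidean_space measure)"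
  using lborel_affine[of "-1" "0 :: 'a"] by (simp add: density_1)

lemma square_integrable_reflect:
  assumes "square_integrable f"
  shows "square_integrable (\<lambda>t. f (- t))"
proof -
  have [measurable]: "f \<in> borel_measurable borel"
    using assms by (auto simp: square_integrable_def)
  have "integrable (distr lborel borel (\<lambda>x. - x)) (\<lambda>x. (norm (f x))\<^sup>2)"
    using assms by (auto simp: square_integrable_def lborel_distr_reflect)
  then have "integrable lborel (\<lambda>x. (norm (f (- x)))\<^sup>2)"
    by (subst (asm) integrable_distr_eq) auto
  then show ?thesis
    by (simp add: square_integrable_def)
qed

lemma AE_lborel_reflect:
  fixes f g :: "'a::euclidean_space \<Rightarrow> complex"
  assumes "AE x in lborel. f x = g x"
    and [measurable]: "f \<in> borel_measurable borel" "g \<in> borel_measurable borel"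
  shows "AE x in lborel. f (- x) = g (- x)"
proof -
  have "AE x in distr lborel borel (\<lambda>x. - x). f x = g x"
    using assms(1) unfolding lborel_distr_reflect .
  then show ?thesis
    by (subst (asm) AE_distr_iff) auto
qed

quotient_type (overloaded) 'a l2 = "'a::euclidean_space \<Rightarrow> complex" / partial: l2_rel
proof (rule part_equivpI)
  show "\<exists>x :: 'a \<Rightarrow> complex. l2_rel x x"
    using square_integrable_zero by (auto simp: l2_rel_def)
  show "symp (l2_rel :: ('a \<Rightarrow> complex) \<Rightarrow> _)"
    unfolding l2_rel_def symp_def by (simp add: eq_commute)
  show "transp (l2_rel :: ('a \<Rightarrow> complex) \<Rightarrow> _)"
  proof (rule transpI)
    fix f g h :: "'a \<Rightarrow> complex"
    assume *: "l2_rel f g" "l2_rel g h"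
    then have "AE x in lborel. f x = g x" "AE x in lborel. g x = h x"
      by (auto simp: l2_rel_def)
    then have "AE x in lborel. f x = h x" by eventually_elim simp
    with * show "l2_rel f h" by (simp add: l2_rel_def)
  qed
qed

lift_definition cinner :: "'a::euclidean_space l2 \<Rightarrow> 'a l2 \<Rightarrow> complex"
  is "\<lambda>f g. \<integral>x. f x * cnj (g x) \<partial>lborel"
proof -
  fix f f' g g' :: "'a \<Rightarrow> complex"
  assume "l2_rel f f'" "l2_rel g g'"
  then have [measurable]: "f \<in> borel_measurable borel" "f' \<in> borel_measurable borel"
      "g \<in> borel_measurable borel" "g' \<in> borel_measurable borel"
    and ae: "AE x in lborel. f x = f' x" "AE x in lborel. g x = g' x"
    by (auto simp: l2_rel_def square_integrable_def)
  from ae have "AE x in lborel. f x * cnj (g x) = f' x * cnj (g' x)"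
    by eventually_elim simp
  then show "(\<integral>x. f x * cnj (g x) \<partial>lborel) = (\<integral>x. f' x * cnj (g' x) \<partial>lborel)"
    by (intro integral_cong_AE) auto
qed

lift_definition scaleC :: "complex \<Rightarrow> 'a::euclidean_space l2 \<Rightarrow> 'a l2" (infixr "*\<^sub>C" 75)
  is "\<lambda>c f x. c * f x"
  by (auto simp: l2_rel_def intro: square_integrable_scale)

instantiation l2 :: (euclidean_space) real_inner
begin

lift_definition zero_l2 :: "'a l2" is "\<lambda>x. 0"
  by (simp add: l2_rel_def square_integrable_zero)

lift_definition plus_l2 :: "'a l2 \<Rightarrow> 'a l2 \<Rightarrow> 'a l2" is "\<lambda>f g x. f x + g x"
  by (auto simp: l2_rel_def intro: square_integrable_add)

definition uminus_l2 :: "'a l2 \<Rightarrow> 'a l2" where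
  "uminus_l2 \<psi> = (- 1) *\<^sub>C \<psi>"

definition minus_l2 :: "'a l2 \<Rightarrow> 'a l2 \<Rightarrow> 'a l2" where
  "minus_l2 \<psi> \<phi> = \<psi> + (- 1) *\<^sub>C \<phi>"

definition scaleR_l2 :: "real \<Rightarrow> 'a l2 \<Rightarrow> 'a l2" where
  "scaleR_l2 r \<psi> = complex_of_real r *\<^sub>C \<psi>"

definition inner_l2 :: "'a l2 \<Rightarrow> 'a l2 \<Rightarrow> real" where
  "inner_l2 \<psi> \<phi> = Re (cinner \<psi> \<phi>)"

definition norm_l2 :: "'a l2 \<Rightarrow> real" where
  "norm_l2 \<psi> = sqrt (inner \<psi> \<psi>)"

definition dist_l2 :: "'a l2 \<Rightarrow> 'a l2 \<Rightarrow> real" where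
  "dist_l2 \<psi> \<phi> = norm (\<psi> - \<phi>)"

definition sgn_l2 :: "'a l2 \<Rightarrow> 'a l2" where
  "sgn_l2 \<psi> = inverse (norm \<psi>) *\<^sub>R \<psi>"

definition uniformity_l2 :: "('a l2 \<times> 'a l2) filter" where
  "uniformity_l2 = (INF e\<in>{0 <..}. principal {(x, y). dist x y < e})"

definition open_l2 :: "'a l2 set \<Rightarrow> bool" where
  "open_l2 U \<longleftrightarrow> (\<forall>x\<in>U. \<forall>\<^sub>F (x', y) in uniformity. x' = x \<longrightarrow> y \<in> U)"

instance
proof
  fix a b c :: "'a l2" and r s :: real
  show "a + b + c = a + (b + c)"
    by transfer (auto simp: l2_rel_def algebra_simps intro!: square_integrable_add)
  show "a + b = b + a"
    by transfer (auto simp: l2_rel_def algebra_simps intro!: square_integrable_add)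
  show "0 + a = a"
    by transfer (auto simp: l2_rel_def)
  show "- a + a = 0"
    unfolding uminus_l2_def
    by transfer (auto simp: l2_rel_def square_integrable_zero)
  show "a - b = a + - b"
    by (simp add: uminus_l2_def minus_l2_def)
  show "r *\<^sub>R (a + b) = r *\<^sub>R a + r *\<^sub>R b"
    unfolding scaleR_l2_def
    by transfer (auto simp: l2_rel_def distrib_left distrib_right
        intro!: square_integrable_add square_integrable_scale)
  show "(r + s) *\<^sub>R a = r *\<^sub>R a + s *\<^sub>R a"
    unfolding scaleR_l2_def
    by transfer (auto simp: l2_rel_def distrib_left distrib_right
        intro!: square_integrable_add square_integrable_scale)
  show "r *\<^sub>R s *\<^sub>R a = (r * s) *\<^sub>R a"
    unfolding scaleR_l2_def
    by transfer (auto simp: l2_rel_def mult.assoc intro!: square_integrable_scale)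
  show "1 *\<^sub>R a = a"
    unfolding scaleR_l2_def
    by transfer (auto simp: l2_rel_def)
  show "inner a b = inner b a"
  proof -
    have "cinner b a = cnj (cinner a b)"
      by transfer (simp flip: Bochner_Integration.integral_cnj add: mult.commute)
    then show ?thesis by (simp add: inner_l2_def)
  qed
  show "inner (a + b) c = inner a c + inner b c"
  proof -
    have "cinner (a + b) c = cinner a c + cinner b c"
      by transfer (auto simp: l2_rel_def algebra_simps
          intro!: Bochner_Integration.integral_add square_integrable_mult_integrable)
    then show ?thesis by (simp add: inner_l2_def)
  qed
  show "inner (r *\<^sub>R a) b = r * inner a b"
  proof -
    have "cinner (r *\<^sub>R a) b = of_real r * cinner a b"
      unfolding scaleR_l2_def by transfer (simp add: mult.assoc)
    then show ?thesis by (simp add: inner_l2_def)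
  qed
  have sq: "(\<integral>x. g x * cnj (g x) \<partial>lborel) = of_real (\<integral>x. (norm (g x))\<^sup>2 \<partial>lborel)"
    for g :: "'a \<Rightarrow> complex"
    by (simp flip: complex_norm_square integral_complex_of_real)
  show "0 \<le> inner a a"
    unfolding inner_l2_def by transfer (simp add: sq)
  show "inner a a = 0 \<longleftrightarrow> a = 0"
    unfolding inner_l2_def
  proof transfer
    fix g :: "'a \<Rightarrow> complex"
    assume g: "l2_rel g g"
    then have "integrable lborel (\<lambda>x. (norm (g x))\<^sup>2)"
      by (auto simp: l2_rel_def square_integrable_def)
    then have "Re (\<integral>x. g x * cnj (g x) \<partial>lborel) = 0 \<longleftrightarrow> (AE x in lborel. g x = 0)"
      by (simp add: sq integral_nonneg_eq_0_iff_AE)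
    also have "\<dots> \<longleftrightarrow> l2_rel g (\<lambda>x. 0)"
      using g by (auto simp: l2_rel_def square_integrable_zero)
    finally show "Re (\<integral>x. g x * cnj (g x) \<partial>lborel) = 0 \<longleftrightarrow> l2_rel g (\<lambda>x. 0)" .
  qed
qed (simp_all add: norm_l2_def dist_l2_def sgn_l2_def uniformity_l2_def open_l2_def)

end


section \<open>Operators\<close>

definition bounded_clinear :: "('a::euclidean_space l2 \<Rightarrow> 'a l2) \<Rightarrow> bool" where
  "bounded_clinear A \<longleftrightarrow> bounded_linear A \<and> (\<forall>c \<psi>. A (c *\<^sub>C \<psi>) = c *\<^sub>C A \<psi>)"

definition cadjoint :: "('a::euclidean_space l2 \<Rightarrow> 'a l2) \<Rightarrow> ('a l2 \<Rightarrow> 'a l2)" where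
  "cadjoint A = (THE B. \<forall>\<psi> \<phi>. cinner (A \<psi>) \<phi> = cinner \<psi> (B \<phi>))"

definition rank_one :: "'a::euclidean_space l2 \<Rightarrow> 'a l2 \<Rightarrow> ('a l2 \<Rightarrow> 'a l2)" where
  "rank_one \<xi> \<eta> = (\<lambda>\<zeta>. cinner \<zeta> \<eta> *\<^sub>C \<xi>)"

definition orthonormal_family :: "'i set \<Rightarrow> ('i \<Rightarrow> 'a::euclidean_space l2) \<Rightarrow> bool" where
  "orthonormal_family I e \<longleftrightarrow> (\<forall>i\<in>I. \<forall>j\<in>I. cinner (e i) (e j) = (if i = j then 1 else 0))"

definition orthonormal_basis :: "'a::euclidean_space l2 set \<Rightarrow> bool" where
  "orthonormal_basis E \<longleftrightarrow>
     orthonormal_family E (\<lambda>e. e) \<and> (\<forall>\<psi>. (\<forall>e\<in>E. cinner \<psi> e = 0) \<longrightarrow> \<psi> = 0)"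

text \<open>An operator is of trace class if it has a singular value decomposition
  \<open>S = \<Sum>\<^sub>n s\<^sub>n \<xi>\<^sub>n \<otimes> \<eta>\<^sub>n\<close> with summable singular values; \<open>N\<close> is a proper subset of the natural
  numbers for operators of finite rank, for instance.\<close>

definition trace_class :: "('a::euclidean_space l2 \<Rightarrow> 'a l2) \<Rightarrow> bool" where
  "trace_class S \<longleftrightarrow> bounded_clinear S \<and>
     (\<exists>(N :: nat set) (s :: nat \<Rightarrow> real) \<xi> \<eta>.
        (\<forall>n\<in>N. 0 < s n) \<and> s summable_on N \<and>
        orthonormal_family N \<xi> \<and> orthonormal_family N \<eta> \<and>
        (\<forall>\<psi>. ((\<lambda>n. complex_of_real (s n) *\<^sub>C rank_one (\<xi> n) (\<eta> n) \<psi>) has_sum S \<psi>) N))"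

definition op_trace :: "('a::euclidean_space l2 \<Rightarrow> 'a l2) \<Rightarrow> complex" where
  "op_trace S =
     (THE t. \<forall>E. orthonormal_basis E \<longrightarrow> ((\<lambda>e. cinner (S e) e) has_sum t) E)"


section \<open>Time-frequency analysis\<close>

lift_definition reflect :: "'a::euclidean_space l2 \<Rightarrow> 'a l2" is "\<lambda>f x. f (- x)"
proof -
  fix f g :: "'a \<Rightarrow> complex"
  assume fg: "l2_rel f g"
  then have "AE x in lborel. f (- x) = g (- x)"
    by (intro AE_lborel_reflect) (auto simp: l2_rel_def square_integrable_def)
  then show "l2_rel (\<lambda>x. f (- x)) (\<lambda>x. g (- x))"
    using fg by (auto simp: l2_rel_def intro: square_integrable_reflect)
qed

definition op_reflect :: "('a::euclidean_space l2 \<Rightarrow> 'a l2) \<Rightarrow> ('a l2 \<Rightarrow> 'a l2)" where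
  "op_reflect A = reflect \<circ> A \<circ> reflect"

lift_definition tf_shift :: "'a::euclidean_space \<times> 'a \<Rightarrow> 'a l2 \<Rightarrow> 'a l2"
  is "\<lambda>(x, \<omega>) f t. exp (2 * of_real pi * \<i> * of_real (\<omega> \<bullet> t)) * f (t - x)"
proof -
  fix z :: "'a \<times> 'a" and f g :: "'a \<Rightarrow> complex"
  assume fg: "l2_rel f g"
  obtain x \<omega> where z: "z = (x, \<omega>)" by (cases z)
  define m where "m = (\<lambda>t. exp (2 * of_real pi * \<i> * of_real (\<omega> \<bullet> t)))"
  have n: "norm (m t) = 1" for t by (simp add: m_def norm_exp_eq_Re)
  have [measurable]: "m \<in> borel_measurable borel"
    unfolding m_def by (intro borel_measurable_continuous_onI continuous_intros)
  have *: "square_integrable (\<lambda>t. m t * h (t - x))" if "square_integrable h" for h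
    using square_integrable_translate[OF that, of x]
    by (auto simp: square_integrable_def norm_mult n)
  have "AE t in lborel. f (t - x) = g (t - x)"
    using fg by (intro AE_lborel_translate) (auto simp: l2_rel_def square_integrable_def)
  then have "AE t in lborel. m t * f (t - x) = m t * g (t - x)"
    by eventually_elim simp
  then have "l2_rel (\<lambda>t. m t * f (t - x)) (\<lambda>t. m t * g (t - x))"
    using fg * by (auto simp: l2_rel_def)
  then show "l2_rel ((case z of (x, \<omega>) \<Rightarrow> \<lambda>f t. exp (2 * of_real pi * \<i> * of_real (\<omega> \<bullet> t)) * f (t - x)) f)
      ((case z of (x, \<omega>) \<Rightarrow> \<lambda>f t. exp (2 * of_real pi * \<i> * of_real (\<omega> \<bullet> t)) * f (t - x)) g)"
    by (simp add: z m_def)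
qed

definition stft :: "'a::euclidean_space l2 \<Rightarrow> 'a l2 \<Rightarrow> 'a \<times> 'a \<Rightarrow> complex" where
  "stft \<phi> \<psi> z = cinner \<psi> (tf_shift z \<phi>)"

definition op_shift ::
  "'a::euclidean_space \<times> 'a \<Rightarrow> ('a l2 \<Rightarrow> 'a l2) \<Rightarrow> ('a l2 \<Rightarrow> 'a l2)" where
  "op_shift z A = tf_shift z \<circ> A \<circ> cadjoint (tf_shift z)"

definition localization_op ::
  "('a::euclidean_space \<times> 'a \<Rightarrow> complex) \<Rightarrow> 'a l2 \<Rightarrow> 'a l2 \<Rightarrow> ('a l2 \<Rightarrow> 'a l2)" where
  "localization_op f \<phi>\<^sub>1 \<phi>\<^sub>2 \<psi> =
     (THE \<xi>. \<forall>\<phi>. has_bochner_integral lborel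
                   (\<lambda>z. f z * stft \<phi>\<^sub>1 \<psi> z * cnj (stft \<phi>\<^sub>2 \<phi> z)) (cinner \<xi> \<phi>))"

definition berezin ::
  "'a::euclidean_space l2 \<Rightarrow> 'a l2 \<Rightarrow> ('a l2 \<Rightarrow> 'a l2) \<Rightarrow> 'a \<times> 'a \<Rightarrow> complex" where
  "berezin \<phi>\<^sub>1 \<phi>\<^sub>2 T z = cinner (T (tf_shift z \<phi>\<^sub>1)) (tf_shift z \<phi>\<^sub>2)"


section \<open>Convolutions\<close>

definition Lp_function :: "ennreal \<Rightarrow> ('b::euclidean_space \<Rightarrow> complex) \<Rightarrow> bool" where
  "Lp_function p f \<longleftrightarrow> f \<in> borel_measurable lborel \<and>
     (if p = \<infinity> then \<exists>C. AE z in lborel. norm (f z) \<le> C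
      else integrable lborel (\<lambda>z. norm (f z) powr enn2real p))"

definition op_op_conv ::
  "('a::euclidean_space l2 \<Rightarrow> 'a l2) \<Rightarrow> ('a l2 \<Rightarrow> 'a l2) \<Rightarrow> 'a \<times> 'a \<Rightarrow> complex" where
  "op_op_conv A S z = op_trace (A \<circ> op_shift z (op_reflect S))"

text \<open>The value at \<open>\<psi>\<close> is the weak vector-valued integral of \<open>f(z) \<alpha>\<^sub>z(S) \<psi>\<close>.\<close>

definition fun_op_conv_L1 ::
  "('a::euclidean_space \<times> 'a \<Rightarrow> complex) \<Rightarrow> ('a l2 \<Rightarrow> 'a l2) \<Rightarrow> ('a l2 \<Rightarrow> 'a l2)" where
  "fun_op_conv_L1 f S \<psi> =
     (THE \<xi>. \<forall>\<phi>. has_bochner_integral lborel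
                   (\<lambda>z. cinner (f z *\<^sub>C op_shift z S \<psi>) \<phi>) (cinner \<xi> \<phi>))"

text \<open>For essentially bounded \<open>f\<close> the operator is defined by trace duality. Here and above,
  \<^const>\<open>has_bochner_integral\<close> includes integrability, so that the default value of the integral
  of a non-integrable function plays no role.\<close>

definition fun_op_conv_Linf ::
  "('a::euclidean_space \<times> 'a \<Rightarrow> complex) \<Rightarrow> ('a l2 \<Rightarrow> 'a l2) \<Rightarrow> ('a l2 \<Rightarrow> 'a l2)" where
  "fun_op_conv_Linf f S =
     (THE B. bounded_clinear B \<and>
        (\<forall>R. trace_class R \<longrightarrow>
           has_bochner_integral lborel
             (\<lambda>z. f z * cnj (op_op_conv R (cadjoint (op_reflect S)) z))
             (op_trace (B \<circ> cadjoint R))))"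

text \<open>The operator does not depend on the decomposition, hence the definite description.\<close>

definition fun_op_conv ::
  "('a::euclidean_space \<times> 'a \<Rightarrow> complex) \<Rightarrow> ('a l2 \<Rightarrow> 'a l2) \<Rightarrow> ('a l2 \<Rightarrow> 'a l2)" where
  "fun_op_conv f S =
     (THE B. \<exists>g h. Lp_function 1 g \<and> Lp_function \<infinity> h \<and>
        (AE z in lborel. f z = g z + h z) \<and>
        B = (\<lambda>\<psi>. fun_op_conv_L1 g S \<psi> + fun_op_conv_Linf h S \<psi>))"

end

theory Submission
  imports Defs "HOL-Probability.Characteristic_Functions"
begin

text \<open>Conjugation by \<open>\<pi>(z)\<close> turns \<open>\<xi> \<otimes> \<eta>\<close> into \<open>\<pi>(z)\<xi> \<otimes> \<pi>(z)\<eta>\<close>, and \<open>tr (\<xi> \<otimes> \<eta>) = \<langle>\<xi>, \<eta>\<rangle>\<close>; this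
  gives the Berezin transform at once and makes the weak integrals that define the two operators coincide
  for integrable symbols. For bounded symbols one expands a trace class operator into its singular
  value decomposition and integrates term by term. The domination that this needs, and the existence
  of the localization operator, come from \<open>\<parallel>V\<^sub>\<phi>\<psi>\<parallel>\<^sub>2 \<le> \<parallel>\<phi>\<parallel> \<parallel>\<psi>\<parallel>\<close>. Since only this inequality is required,
  Plancherel's theorem is replaced by \<open>\<integral>|F g|\<^sup>2 \<le> \<integral>|g|\<^sup>2\<close> for the Fourier transform \<open>F g\<close> of an integrable
  function \<open>g\<close>: a Gaussian weight on the left becomes a convolution kernel of mass one on the right,
  so that Schur's test applies, and then the weight is removed by Fatou's lemma.\<close>

section \<open>The Hilbert space structure of \<open>L\<^sup>2\<close>\<close>

text \<open>Adjoints, traces, localization operators and convolutions are all definite descriptions,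
  so existence and uniqueness must come before any computation. For adjoints and localization
  operators existence is Riesz representation, which rests on completeness of the quotient space.
  For the trace one needs an orthonormal basis and independence of its choice. For a bounded symbol,
  testing on rank-one operators singles out the convolution. No estimate for intermediate exponents
  enters: \<open>bounded_symbol\<close> isolates absolute convergence of the weak form together with
  a bound by the norms of its arguments, is verified for integrable and for bounded symbols, and the
  two cases are added. The Fourier bound is stated for integrable functions and extended-valued
  integrals because, for square integrable f and h, the slice f(t) cnj(h(t - x)) is integrable for
  every x, whereas its square may have infinite integral for some x.\<close>

lemma cinner_add_left: "cinner (a + b) c = cinner a c + cinner b c"
  by transfer (auto simp: l2_rel_def algebra_simps
      intro!: Bochner_Integration.integral_add square_integrable_mult_integrable)

lemma cinner_commute: "cinner b a = cnj (cinner a b)"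
  by transfer (simp flip: Bochner_Integration.integral_cnj add: mult.commute)

lemma cinner_add_right: "cinner a (b + c) = cinner a b + cinner a c"
  by (metis cinner_add_left cinner_commute complex_cnj_add)

lemma cinner_scaleC_left: "cinner (c *\<^sub>C a) b = c * cinner a b"
  by transfer (simp add: mult.assoc)

lemma cinner_scaleC_right: "cinner a (c *\<^sub>C b) = cnj c * cinner a b"
  by (metis cinner_scaleC_left cinner_commute complex_cnj_mult)

lemma scaleC_of_real: "complex_of_real r *\<^sub>C a = r *\<^sub>R a"
  by (simp add: scaleR_l2_def)

lemma cinner_minus_left: "cinner (a - b) c = cinner a c - cinner b c"
  by (simp add: minus_l2_def cinner_add_left cinner_scaleC_left)

lemma cinner_minus_right: "cinner c (a - b) = cinner c a - cinner c b"
  by (simp add: minus_l2_def cinner_add_right cinner_scaleC_right)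

lemma cinner_scaleR_left: "cinner (r *\<^sub>R a) b = of_real r * cinner a b"
  by (simp add: cinner_scaleC_left flip: scaleC_of_real)

lemma cinner_scaleR_right: "cinner a (r *\<^sub>R b) = of_real r * cinner a b"
  by (simp add: cinner_scaleC_right flip: scaleC_of_real)

lemma cinner_zero [simp]: "cinner 0 a = 0" "cinner a 0 = 0"
  using cinner_minus_left[of a a a] cinner_minus_right[of a a a]
        cinner_minus_left[of 0 0 a] cinner_minus_right[of a 0 0] by simp_all

lemma cinner_self: "cinner a a = of_real ((norm a)\<^sup>2)"
proof -
  have "Im (cinner a a) = 0"
    using cinner_commute[of a a] by (simp add: complex_eq_iff)
  then show ?thesis
    by (simp add: complex_eq_iff power2_norm_eq_inner inner_l2_def)
qed

lemma norm_scaleC: "norm (c *\<^sub>C a) = norm c * norm a"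
proof -
  have "complex_of_real ((norm (c *\<^sub>C a))\<^sup>2) = complex_of_real ((norm c * norm a)\<^sup>2)"
    unfolding cinner_self[symmetric] power_mult_distrib of_real_mult complex_norm_square
    by (simp add: cinner_scaleC_left cinner_scaleC_right)
  then have "(norm (c *\<^sub>C a))\<^sup>2 = (norm c * norm a)\<^sup>2"
    using of_real_eq_iff by blast
  then show ?thesis
    by (simp add: power2_eq_iff_nonneg)
qed

lemma norm_cinner_le: "norm (cinner a b) \<le> norm a * norm b"
proof (cases "cinner a b = 0")
  case False
  define c where "c = cnj (cinner a b) / norm (cinner a b)"
  have c: "norm c = 1" using False by (simp add: c_def norm_divide)
  have "c * cinner a b = norm (cinner a b)"
    using False by (simp add: c_def mult.commute power2_eq_square flip: complex_norm_square)
  then have "norm (cinner a b) = inner (c *\<^sub>C a) b"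
    by (simp add: inner_l2_def cinner_scaleC_left)
  also have "\<dots> \<le> norm (c *\<^sub>C a) * norm b" by (rule norm_cauchy_schwarz)
  finally show ?thesis by (simp add: norm_scaleC c)
qed simp

lemma cinner_eqI:
  assumes "\<And>\<phi>. cinner \<xi> \<phi> = cinner \<eta> \<phi>" shows "\<xi> = \<eta>"
proof -
  have "cinner (\<xi> - \<eta>) (\<xi> - \<eta>) = 0" by (simp add: cinner_minus_left assms)
  then show ?thesis by (simp add: cinner_self)
qed

section \<open>Representatives and completeness\<close>

lemma l2_cases:
  obtains f where "square_integrable f" "x = abs_l2 f"
proof
  show "square_integrable (rep_l2 x)"
    using Quotient_rep_reflp[OF Quotient_l2, of x] by (simp add: l2_rel_def)
  show "x = abs_l2 (rep_l2 x)"
    using Quotient_abs_rep[OF Quotient_l2, of x] by simp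
qed

lemma l2_rel_refl: "square_integrable f \<Longrightarrow> l2_rel f f"
  by (simp add: l2_rel_def)

lemma cinner_abs:
  assumes "square_integrable f" "square_integrable g"
  shows "cinner (abs_l2 f) (abs_l2 g) = (\<integral>x. f x * cnj (g x) \<partial>lborel)"
  using assms by (intro cinner.abs_eq) (auto simp: l2_rel_refl)

lemma minus_abs:
  assumes "square_integrable f" "square_integrable g"
  shows "abs_l2 f - abs_l2 g = abs_l2 (\<lambda>x. f x - g x)"
  using assms square_integrable_scale[OF assms(2), of "-1"]
  by (simp add: minus_l2_def scaleC.abs_eq plus_l2.abs_eq l2_rel_refl)

lemma square_integrable_diff:
  assumes "square_integrable f" "square_integrable g"
  shows "square_integrable (\<lambda>x. f x - g x)"
  using square_integrable_add[OF assms(1) square_integrable_scale[OF assms(2), of "-1"]] by simp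

lemma nn_integral_norm_abs:
  assumes "square_integrable f"
  shows "(\<integral>\<^sup>+ x. ennreal ((norm (f x))\<^sup>2) \<partial>lborel) = ennreal ((norm (abs_l2 f))\<^sup>2)"
proof -
  have "(\<integral>x. f x * cnj (f x) \<partial>lborel) = of_real (\<integral>x. (norm (f x))\<^sup>2 \<partial>lborel)"
    by (simp flip: complex_norm_square integral_complex_of_real)
  then have "complex_of_real ((norm (abs_l2 f))\<^sup>2) = of_real (\<integral>x. (norm (f x))\<^sup>2 \<partial>lborel)"
    using cinner_self[of "abs_l2 f"] cinner_abs[OF assms assms] by simp
  then have "(norm (abs_l2 f))\<^sup>2 = (\<integral>x. (norm (f x))\<^sup>2 \<partial>lborel)"
    using of_real_eq_iff by blast
  then show ?thesis
    using assms by (simp add: square_integrable_def nn_integral_eq_integral)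
qed

text \<open>Riesz--Fischer: for a subsequence with \<open>\<parallel>u\<^sub>n\<^sub>+\<^sub>1 - u\<^sub>n\<parallel>\<^sup>2 \<le> 4\<^sup>-\<^sup>n\<close> the elementary bound
  \<open>2a \<le> 2\<^sup>-\<^sup>n + 2\<^sup>n a\<^sup>2\<close> gives almost everywhere absolute convergence without Minkowski's inequality.\<close>

instance l2 :: (euclidean_space) complete_space
proof
  fix X :: "nat \<Rightarrow> 'a l2"
  assume X: "Cauchy X"
  have "\<exists>N. \<forall>m\<ge>N. \<forall>n\<ge>N. norm (X m - X n) < (1/2) ^ k" for k :: nat
    using CauchyD[OF X, of "(1/2)^k"] by simp
  then obtain N where N: "\<And>k m n. m \<ge> N k \<Longrightarrow> n \<ge> N k \<Longrightarrow> norm (X m - X n) < (1/2) ^ k"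
    by metis
  \<comment> \<open>The sum dominates every \<open>N j\<close> with j at most k, so one index
    sequence serves all earlier tolerances.\<close>
  define r where "r k = (\<Sum>j\<le>k. N j)" for k
  have r_ge: "N j \<le> r k" if "j \<le> k" for j k
    unfolding r_def using that by (intro member_le_sum) auto
  have "\<exists>f. square_integrable f \<and> X (r k) = abs_l2 f" for k by (metis l2_cases)
  then obtain u where u: "\<And>k. square_integrable (u k)" "\<And>k. X (r k) = abs_l2 (u k)"
    by metis
  have [measurable]: "u k \<in> borel_measurable borel" for k
    using u(1)[of k] by (simp add: square_integrable_def)
  have quarter: "((1/2) ^ n)\<^sup>2 = (1/4::real) ^ n" for n
    by (simp add: power2_eq_square flip: power_mult_distrib)
  have dist_u: "(\<integral>\<^sup>+ x. ennreal ((norm (u j x - u k x))\<^sup>2) \<partial>lborel) \<le> ennreal ((1/4) ^ n)"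
    if "n \<le> j" "n \<le> k" for j k n
  proof -
    have "norm (X (r j) - X (r k)) \<le> (1/2)^n" using N[OF r_ge r_ge, OF that] by simp
    then have "(norm (X (r j) - X (r k)))\<^sup>2 \<le> (1/4) ^ n"
      unfolding quarter[symmetric] by (intro power_mono) auto
    then show ?thesis
      unfolding nn_integral_norm_abs[OF square_integrable_diff[OF u(1) u(1)]]
      by (intro ennreal_leI) (simp add: u minus_abs)
  qed
  have "(\<integral>\<^sup>+ x. (\<Sum>n. ennreal (2 ^ n * (norm (u (Suc n) x - u n x))\<^sup>2)) \<partial>lborel)
      = (\<Sum>n. (\<integral>\<^sup>+ x. ennreal (2 ^ n * (norm (u (Suc n) x - u n x))\<^sup>2) \<partial>lborel))"
    by (rule nn_integral_suminf) measurable
  also have "\<dots> \<le> (\<Sum>n. ennreal ((1/2)^n))"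
  proof (intro suminf_le allI summableI)
    fix n
    have "(\<integral>\<^sup>+ x. ennreal (2 ^ n * (norm (u (Suc n) x - u n x))\<^sup>2) \<partial>lborel)
        = ennreal (2^n) * (\<integral>\<^sup>+ x. ennreal ((norm (u (Suc n) x - u n x))\<^sup>2) \<partial>lborel)"
      by (simp add: ennreal_mult nn_integral_cmult)
    also have "\<dots> \<le> ennreal (2^n) * ennreal ((1/4)^n)"
      by (intro mult_left_mono dist_u) auto
    also have "\<dots> = ennreal ((1/2)^n)"
      by (simp flip: ennreal_mult power_mult_distrib)
    finally show "(\<integral>\<^sup>+ x. ennreal (2 ^ n * (norm (u (Suc n) x - u n x))\<^sup>2) \<partial>lborel)
        \<le> ennreal ((1/2)^n)" .
  qed
  also have "\<dots> < \<infinity>"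
    by (simp add: ennreal_suminf_neq_top less_top[symmetric])
  finally have "AE x in lborel. (\<Sum>n. ennreal (2 ^ n * (norm (u (Suc n) x - u n x))\<^sup>2)) \<noteq> \<infinity>"
    by (intro nn_integral_PInf_AE) auto
  then have conv: "AE x in lborel. convergent (\<lambda>n. u n x)"
  proof eventually_elim
    case (elim x)
    let ?a = "\<lambda>n. norm (u (Suc n) x - u n x)"
    have s: "summable (\<lambda>n. 2 ^ n * (?a n)\<^sup>2)"
      using elim by (intro summable_suminf_not_top) auto
    have "summable (\<lambda>n. (1/2) ^ n + 2 ^ n * (?a n)\<^sup>2)" (is "summable ?g")
      by (intro summable_add s summable_geometric) auto
    moreover have "?a n \<le> (1/2) ^ n + 2 ^ n * (?a n)\<^sup>2" for n
    proof -
      have "0 \<le> (1/2)^n * (1 - 2^n * ?a n)\<^sup>2" by simp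
      also have "\<dots> = (1/2)^n + 2^n * (?a n)\<^sup>2 - 2 * ?a n"
        by (simp add: power2_eq_square algebra_simps power_one_over)
      finally show ?thesis using norm_ge_zero[of "u (Suc n) x - u n x"] by linarith
    qed
    ultimately have "summable ?a"
      by (intro summable_comparison_test'[where N=0 and g="?g" and f="?a"]) (simp_all only: real_norm_def abs_norm_cancel)
    then have "summable (\<lambda>n. u (Suc n) x - u n x)" by (rule summable_norm_cancel)
    then have "convergent (\<lambda>n. \<Sum>k<n. u (Suc k) x - u k x)"
      by (simp add: summable_iff_convergent)
    then have "convergent (\<lambda>n. u n x - u 0 x)"
      using sum_lessThan_telescope[of "\<lambda>k. u k x"] by simp
    then show ?case
      by (simp add: convergent_diff_const_right_iff)
  qed
  \<comment> \<open>On the null set of divergence \<open>lim\<close> is some default value;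
    \<open>v\<close> is measurable all the same and the integrals do not see that set.\<close>
  define v where "v x = lim (\<lambda>n. u n x)" for x
  have [measurable]: "v \<in> borel_measurable borel" unfolding v_def by measurable
  \<comment> \<open>Fatou's lemma in the second index passes the rate between members of the
    subsequence on to the limit.\<close>
  have uv: "(\<integral>\<^sup>+ x. ennreal ((norm (u n x - v x))\<^sup>2) \<partial>lborel) \<le> ennreal ((1/4) ^ n)" for n
  proof -
    have "(\<integral>\<^sup>+ x. ennreal ((norm (u n x - v x))\<^sup>2) \<partial>lborel)
       = (\<integral>\<^sup>+ x. liminf (\<lambda>k. ennreal ((norm (u n x - u k x))\<^sup>2)) \<partial>lborel)"
    proof (rule nn_integral_cong_AE, use conv in eventually_elim)
      case (elim x)
      then have "(\<lambda>k. u k x) \<longlonglongrightarrow> v x" by (simp add: v_def convergent_LIMSEQ_iff)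
      then have "(\<lambda>k. ennreal ((norm (u n x - u k x))\<^sup>2)) \<longlonglongrightarrow> ennreal ((norm (u n x - v x))\<^sup>2)"
        by (intro tendsto_intros tendsto_ennrealI)
      from lim_imp_Liminf[OF _ this] show ?case by simp
    qed
    also have "\<dots> \<le> liminf (\<lambda>k. \<integral>\<^sup>+ x. ennreal ((norm (u n x - u k x))\<^sup>2) \<partial>lborel)"
      by (intro nn_integral_liminf) auto
    also have "\<dots> \<le> limsup (\<lambda>k. \<integral>\<^sup>+ x. ennreal ((norm (u n x - u k x))\<^sup>2) \<partial>lborel)"
      by (rule Liminf_le_Limsup) simp
    also have "\<dots> \<le> ennreal ((1/4) ^ n)"
      by (rule Limsup_bounded) (use dist_u in \<open>auto intro!: eventually_sequentiallyI[of n]\<close>)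
    finally show ?thesis .
  qed
  have si: "square_integrable (\<lambda>x. u n x - v x)" for n
    unfolding square_integrable_def
    using uv[of n] by (auto intro!: integrableI_bounded simp: less_top[symmetric] top_unique)
  have v: "square_integrable v"
    using square_integrable_diff[OF u(1)[of 0] si[of 0]] by simp
  have "norm (X (r n) - abs_l2 v) \<le> (1/2) ^ n" for n
  proof -
    have "(norm (X (r n) - abs_l2 v))\<^sup>2 \<le> (1/4)^n"
      using uv[of n] nn_integral_norm_abs[OF si, of n] u v by (simp add: minus_abs)
    then have "(norm (X (r n) - abs_l2 v))\<^sup>2 \<le> ((1/2)^n)\<^sup>2"
      by (simp only: quarter)
    then show ?thesis by (rule power2_le_imp_le) simp
  qed
  note close = this
  have "X \<longlonglongrightarrow> abs_l2 v"
  proof (rule LIMSEQ_I)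
    fix e :: real assume "e > 0"
    then obtain k where k: "(1/2)^k < e / 2"
      using real_arch_pow_inv[of "e/2" "1/2"] by auto
    have "norm (X n - abs_l2 v) < e" if "n \<ge> N k" for n
    proof -
      have "norm (X n - abs_l2 v) \<le> norm (X n - X (r k)) + norm (X (r k) - abs_l2 v)"
        using norm_triangle_ineq[of "X n - X (r k)" "X (r k) - abs_l2 v"] by simp
      then show ?thesis using N[OF that r_ge[of k k]] close[of k] k by simp
    qed
    then show "\<exists>no. \<forall>n\<ge>no. norm (X n - abs_l2 v) < e" by blast
  qed
  then show "convergent X" by (rule convergentI)
qed

section \<open>Riesz representation\<close>

text \<open>Direct method: the functional \<open>J\<close> is bounded below, the parallelogram law
  makes a minimising sequence Cauchy, and its limit represents \<open>L\<close>, since otherwise a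
  small move along some x would lower \<open>J\<close> further.\<close>

lemma bounded_linear_repr:
  fixes L :: "'b::{real_inner, complete_space} \<Rightarrow> real"
  assumes "bounded_linear L"
  shows "\<exists>a. \<forall>x. L x = inner a x"
proof -
  interpret bounded_linear L by fact
  define J where "J x = (norm x)\<^sup>2 / 2 - L x" for x
  obtain K where K: "\<And>x. norm (L x) \<le> norm x * K" using bounded by blast
  have bdd: "bdd_below (range J)"
  proof (rule bdd_belowI2)
    fix x
    have "L x \<le> norm x * K" using K[of x] by simp
    moreover have "0 \<le> (norm x - K)\<^sup>2" by simp
    \<comment> \<open>Completing the square in \<open>norm x\<close>: the lower bound is the minimum
      of r^2/2 - K r over real r.\<close>
    ultimately show "- (K\<^sup>2) / 2 \<le> J x"
      by (simp add: J_def power2_eq_square algebra_simps)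
  qed
  define m where "m = Inf (range J)"
  have m: "m \<le> J x" for x unfolding m_def using bdd by (simp add: cInf_lower)
  \<comment> \<open>At the midpoint the linear parts cancel and the parallelogram law remains; the
    midpoint value is at least \<open>m\<close>.\<close>
  have para: "(norm (x - y))\<^sup>2 \<le> 4 * (J x + J y - 2 * m)" for x y
  proof -
    have "(norm (x - y))\<^sup>2 = 4 * (J x + J y - 2 * J ((1/2) *\<^sub>R (x + y)))"
      unfolding J_def
      by (simp add: add scaleR power2_norm_eq_inner inner_simps inner_commute algebra_simps)
    then show ?thesis using m[of "(1/2) *\<^sub>R (x + y)"] by simp
  qed
  have "\<exists>x. J x < m + 1 / real (Suc n)" for n
  proof -
    have "Inf (range J) < m + 1 / real (Suc n)" unfolding m_def by simp
    then show ?thesis using bdd by (subst (asm) cInf_less_iff) auto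
  qed
  then obtain X where X: "\<And>n. J (X n) < m + 1 / real (Suc n)" by metis
  have "Cauchy X"
  proof (rule CauchyI)
    fix e :: real assume e: "e > 0"
    \<comment> \<open>Two excesses of e^2/8, multiplied by the factor 4 of \<open>para\<close>, add
      up to e^2.\<close>
    then obtain k where k: "1 / real (Suc k) < e\<^sup>2 / 8"
      using nat_approx_posE[of "e\<^sup>2 / 8"] by auto
    have "norm (X i - X j) < e" if ij: "i \<ge> k" "j \<ge> k" for i j
    proof -
      have "1 / real (Suc i) \<le> 1 / real (Suc k)" "1 / real (Suc j) \<le> 1 / real (Suc k)"
        using ij by (auto intro!: divide_left_mono)
      then have "J (X i) < m + e\<^sup>2 / 8" "J (X j) < m + e\<^sup>2 / 8"
        using X[of i] X[of j] k by argo+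
      then have "4 * (J (X i) + J (X j) - 2 * m) < e\<^sup>2"
        by argo
      then have "(norm (X i - X j))\<^sup>2 < e\<^sup>2" using para[of "X i" "X j"] by linarith
      then show ?thesis using e by (simp add: power2_less_imp_less)
    qed
    then show "\<exists>M. \<forall>i\<ge>M. \<forall>j\<ge>M. norm (X i - X j) < e" by blast
  qed
  then obtain a where a: "X \<longlonglongrightarrow> a" using Cauchy_convergent convergent_def by blast
  have "(\<lambda>n. J (X n)) \<longlonglongrightarrow> J a"
    unfolding J_def by (intro tendsto_intros tendsto a) simp
  moreover have "(\<lambda>n. m + 1 / real (Suc n)) \<longlonglongrightarrow> m + 0"
    by (intro tendsto_add tendsto_const LIMSEQ_Suc lim_1_over_n)
  ultimately have "J a \<le> m"
    using X by (intro LIMSEQ_le[of "\<lambda>n. J (X n)" _ "\<lambda>n. m + 1 / real (Suc n)"]) (auto intro: less_imp_le)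
  then have Ja: "J a \<le> J x" for x using m[of x] by simp
  have "L x = inner a x" for x
  proof (rule ccontr)
    assume ne: "L x \<noteq> inner a x"
    define d where "d = L x - inner a x"
    \<comment> \<open>The optimal step would be d / (norm x)^2; adding 1 to the denominator keeps it
      positive for x = 0 and still lowers \<open>J\<close> by at least d^2 / (2 q).\<close>
    define q where "q = (norm x)\<^sup>2 + 1"
    have q: "q > 0" by (simp add: q_def add_nonneg_pos)
    have "J (a + t *\<^sub>R x) = J a - t * d + t\<^sup>2 * (norm x)\<^sup>2 / 2" for t
      unfolding J_def d_def power2_norm_eq_inner
      by (simp add: add scaleR inner_simps inner_commute power2_eq_square field_simps)
    then have "0 \<le> - (d * d / q) + (d / q)\<^sup>2 * (norm x)\<^sup>2 / 2"
      using Ja[of "a + (d / q) *\<^sub>R x"] by simp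
    also have "\<dots> \<le> - (d * d / q) + (d / q)\<^sup>2 * q / 2"
      by (simp add: q_def mult_left_mono)
    also have "\<dots> = - (d * d / q) / 2"
      using q by (simp add: power2_eq_square field_simps)
    also have "\<dots> < 0"
    proof -
      have "d \<noteq> 0" using ne by (simp add: d_def)
      then have "0 < d * d" by (metis not_real_square_gt_zero)
      then show ?thesis using q by simp
    qed
    finally show False by simp
  qed
  then show ?thesis by blast
qed

text \<open>A complex linear functional is determined by its real part, to which the real theorem
  applies. The representative stands in the second slot because the first one is the linear
  one.\<close>

lemma clinear_functional_repr:
  fixes L :: "'a::euclidean_space l2 \<Rightarrow> complex"
  assumes add: "\<And>x y. L (x + y) = L x + L y"
    and scale: "\<And>c x. L (c *\<^sub>C x) = c * L x"
    and bound: "\<And>x. norm (L x) \<le> K * norm x"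
  shows "\<exists>a. \<forall>x. L x = cinner x a"
proof -
  have "bounded_linear (\<lambda>x. Re (L x))"
  proof (rule bounded_linear_intro)
    fix x :: "'a l2"
    show "norm (Re (L x)) \<le> norm x * K"
      using bound[of x] abs_Re_le_cmod[of "L x"] by (simp add: mult.commute)
  qed (simp_all add: add scale flip: scaleC_of_real)
  then obtain a where a: "\<And>x. Re (L x) = inner a x" using bounded_linear_repr by blast
  have "L x = cinner x a" for x
  proof -
    \<comment> \<open>Multiplying the argument by -i turns the imaginary part of \<open>L x\<close>
      into a real part.\<close>
    have "Re (L (- \<i> *\<^sub>C x)) = Re (cinner (- \<i> *\<^sub>C x) a)"
      unfolding a by (subst inner_commute) (simp only: inner_l2_def)
    then show ?thesis
      using a[of x] inner_commute[of a x]
      by (simp add: complex_eq_iff inner_l2_def scale cinner_scaleC_left)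
  qed
  then show ?thesis by blast
qed


section \<open>Adjoints, orthonormal expansions and traces\<close>

lemma bounded_clinearD:
  assumes "bounded_clinear A"
  shows "A (x + y) = A x + A y" "A (c *\<^sub>C x) = c *\<^sub>C A x" "\<exists>K\<ge>0. \<forall>x. norm (A x) \<le> K * norm x"
proof -
  interpret bounded_linear A using assms by (simp add: bounded_clinear_def)
  show "A (x + y) = A x + A y" by (rule add)
  show "A (c *\<^sub>C x) = c *\<^sub>C A x" using assms by (simp add: bounded_clinear_def)
  show "\<exists>K\<ge>0. \<forall>x. norm (A x) \<le> K * norm x"
    using nonneg_bounded by (auto simp: mult.commute)
qed

lemma bounded_clinearI:
  assumes "\<And>x y. A (x + y) = A x + A y" "\<And>c x. A (c *\<^sub>C x) = c *\<^sub>C A x"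
    "\<And>x. norm (A x) \<le> K * norm x"
  shows "bounded_clinear A"
  unfolding bounded_clinear_def
proof
  show "bounded_linear A"
    using assms by (intro bounded_linear_intro[where K=K]) (auto simp: mult.commute simp flip: scaleC_of_real)
qed (use assms in auto)

section \<open>Adjoints and rank-one operators\<close>

text \<open>The inner product separates vectors, so there is at most one adjoint; exhibiting a
  candidate therefore evaluates the definite description.\<close>

lemma cadjoint_eqI:
  assumes "\<And>\<psi> \<phi>. cinner (A \<psi>) \<phi> = cinner \<psi> (B \<phi>)"
  shows "cadjoint A = B"
  unfolding cadjoint_def
proof (rule the_equality)
  show "\<forall>\<psi> \<phi>. cinner (A \<psi>) \<phi> = cinner \<psi> (B \<phi>)" using assms by blast
next
  fix C assume C: "\<forall>\<psi> \<phi>. cinner (A \<psi>) \<phi> = cinner \<psi> (C \<phi>)"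
  show "C = B"
  proof
    fix \<phi>
    show "C \<phi> = B \<phi>"
      by (rule cinner_eqI) (metis C assms cinner_commute)
  qed
qed

lemma cinner_cadjoint:
  assumes "bounded_clinear A"
  shows "cinner (A \<psi>) \<phi> = cinner \<psi> (cadjoint A \<phi>)"
proof -
  obtain K where K: "\<And>x. norm (A x) \<le> K * norm x" using bounded_clinearD(3)[OF assms] by blast
  have "\<exists>b. \<forall>\<psi>. cinner (A \<psi>) \<phi> = cinner \<psi> b" for \<phi>
  proof (rule clinear_functional_repr)
    fix \<psi>
    have "norm (cinner (A \<psi>) \<phi>) \<le> norm (A \<psi>) * norm \<phi>" by (rule norm_cinner_le)
    also have "\<dots> \<le> (K * norm \<psi>) * norm \<phi>" by (intro mult_right_mono K) simp
    finally show "norm (cinner (A \<psi>) \<phi>) \<le> (K * norm \<phi>) * norm \<psi>" by (simp add: mult_ac)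
  qed (simp_all add: bounded_clinearD(1,2)[OF assms] cinner_add_left cinner_scaleC_left)
  then obtain B where "\<And>\<psi> \<phi>. cinner (A \<psi>) \<phi> = cinner \<psi> (B \<phi>)" by metis
  moreover from this have "cadjoint A = B" by (rule cadjoint_eqI)
  ultimately show ?thesis by simp
qed

lemma cinner_cadjoint':
  assumes "bounded_clinear A"
  shows "cinner (cadjoint A \<psi>) \<phi> = cinner \<psi> (A \<phi>)"
  by (metis assms cinner_cadjoint cinner_commute)

lemma cadjoint_rank_one: "cadjoint (rank_one \<xi> \<eta>) = rank_one \<eta> \<xi>"
proof (rule cadjoint_eqI)
  fix \<psi> \<phi>
  show "cinner (rank_one \<xi> \<eta> \<psi>) \<phi> = cinner \<psi> (rank_one \<eta> \<xi> \<phi>)"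
    by (simp add: rank_one_def cinner_scaleC_left cinner_scaleC_right cinner_commute[of \<phi> \<xi>])
qed

lemma bounded_clinear_rank_one: "bounded_clinear (rank_one \<xi> \<eta>)"
proof (rule bounded_clinearI)
  fix x
  have "norm (cinner x \<eta>) * norm \<xi> \<le> (norm x * norm \<eta>) * norm \<xi>"
    by (intro mult_right_mono norm_cinner_le) simp
  then show "norm (rank_one \<xi> \<eta> x) \<le> (norm \<eta> * norm \<xi>) * norm x"
    by (simp add: rank_one_def norm_scaleC mult_ac)
qed (auto simp: rank_one_def intro!: cinner_eqI
    simp: cinner_scaleC_left cinner_add_left algebra_simps)

lemma scaleC_zero [simp]: "0 *\<^sub>C a = 0" "c *\<^sub>C 0 = 0"
  by (auto intro!: cinner_eqI simp: cinner_scaleC_left)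

lemma trace_class_rank_one: "trace_class (rank_one \<xi> \<eta>)"
proof (cases "\<xi> = 0 \<or> \<eta> = 0")
  case True
  \<comment> \<open>Singular values are required to be positive, so the zero operator gets the empty
    index set.\<close>
  then have "rank_one \<xi> \<eta> = (\<lambda>x. 0)" by (auto simp: rank_one_def)
  then show ?thesis
    unfolding trace_class_def using bounded_clinear_rank_one[of \<xi> \<eta>]
    by (auto intro!: exI[of _ "{}"] simp: orthonormal_family_def)
next
  case False
  \<comment> \<open>After normalising both vectors, the product of their norms is the only singular
    value.\<close>
  have unit: "cinner ((1 / norm a) *\<^sub>R a) ((1 / norm a) *\<^sub>R a) = 1" if "a \<noteq> 0" for a :: "'a l2"
    using that by (simp add: cinner_self)
  show ?thesis unfolding trace_class_def
  proof (intro conjI bounded_clinear_rank_one exI allI ballI)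
    show "orthonormal_family {0} (\<lambda>n::nat. (1 / norm \<xi>) *\<^sub>R \<xi>)"
      "orthonormal_family {0} (\<lambda>n::nat. (1 / norm \<eta>) *\<^sub>R \<eta>)"
      unfolding orthonormal_family_def using unit False by auto
    fix \<psi>
    have "complex_of_real (norm \<xi> * norm \<eta>) *\<^sub>C rank_one ((1 / norm \<xi>) *\<^sub>R \<xi>) ((1 / norm \<eta>) *\<^sub>R \<eta>) \<psi>
      = rank_one \<xi> \<eta> \<psi>"
      using False
      by (intro cinner_eqI)
        (simp add: rank_one_def cinner_scaleC_left cinner_scaleR_left cinner_scaleR_right field_simps)
    then show "((\<lambda>n. complex_of_real (norm \<xi> * norm \<eta>) *\<^sub>C
       rank_one ((1 / norm \<xi>) *\<^sub>R \<xi>) ((1 / norm \<eta>) *\<^sub>R \<eta>) \<psi>) has_sum rank_one \<xi> \<eta> \<psi>) {0::nat}"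
      using has_sum_finite[of "{0::nat}" "\<lambda>n. rank_one \<xi> \<eta> \<psi>"] by simp
  qed (use False in auto)
qed

section \<open>Orthonormal bases, Bessel and Parseval\<close>

text \<open>Zorn's lemma: a maximal orthonormal set is total, since a nonzero vector orthogonal to
  it could be normalised and adjoined.\<close>

lemma ex_orthonormal_basis: "\<exists>E :: 'a::euclidean_space l2 set. orthonormal_basis E"
proof -
  define \<C> where "\<C> = {E :: 'a l2 set. orthonormal_family E (\<lambda>e. e)}"
  have "\<exists>M\<in>\<C>. \<forall>X\<in>\<C>. M \<subseteq> X \<longrightarrow> X = M"
  proof (rule subset_Zorn')
    fix C assume C: "subset.chain \<C> C"
    then have sub: "C \<subseteq> \<C>" by (simp add: subset_chain_def)
    have "cinner x y = (if x = y then 1 else 0)" if "X \<in> C" "x \<in> X" "Y \<in> C" "y \<in> Y" for x y X Y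
    proof -
      have "X \<subseteq> Y \<or> Y \<subseteq> X" using C that by (auto simp: subset_chain_def)
      then have "\<exists>Z\<in>C. x \<in> Z \<and> y \<in> Z" using that by auto
      then show ?thesis using sub by (auto simp: \<C>_def orthonormal_family_def)
    qed
    then show "\<Union>C \<in> \<C>" unfolding \<C>_def orthonormal_family_def by blast
  qed
  then obtain M where M: "M \<in> \<C>" "\<And>X. X \<in> \<C> \<Longrightarrow> M \<subseteq> X \<Longrightarrow> X = M" by blast
  have "\<psi> = 0" if orth: "\<forall>e\<in>M. cinner \<psi> e = 0" for \<psi>
  proof (rule ccontr)
    assume "\<psi> \<noteq> 0"
    define e where "e = (1 / norm \<psi>) *\<^sub>R \<psi>"
    have e: "cinner e e = 1" "\<And>x. x \<in> M \<Longrightarrow> cinner e x = 0"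
      using \<open>\<psi> \<noteq> 0\<close> orth by (auto simp: e_def cinner_self cinner_scaleR_left)
    moreover from e(2) have "\<And>x. x \<in> M \<Longrightarrow> cinner x e = 0" by (metis cinner_commute complex_cnj_zero)
    moreover have "e \<notin> M" using e by auto
    ultimately have "insert e M \<in> \<C>"
      using M(1) unfolding \<C>_def orthonormal_family_def by auto
    then show False using M(2)[of "insert e M"] \<open>e \<notin> M\<close> by auto
  qed
  then show ?thesis using M(1) by (auto simp: \<C>_def orthonormal_basis_def)
qed

lemma norm_orthonormal:
  assumes "orthonormal_family I e" "i \<in> I"
  shows "norm (e i) = 1"
proof -
  have "cinner (e i) (e i) = 1" using assms by (simp add: orthonormal_family_def)
  then have "complex_of_real ((norm (e i))\<^sup>2) = 1" by (simp add: cinner_self)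
  then have "(norm (e i))\<^sup>2 = 1" using of_real_eq_1_iff by blast
  then have "norm (e i) = 1 \<or> norm (e i) = - 1" by (simp add: power2_eq_1_iff)
  then show ?thesis using norm_ge_zero[of "e i"] by linarith
qed

lemma cinner_sum_left: "cinner (sum f F) a = (\<Sum>x\<in>F. cinner (f x) a)"
  by (induction F rule: infinite_finite_induct) (auto simp: cinner_add_left)

lemma cinner_mult_swap: "cinner a b * cinner b a = of_real ((norm (cinner a b))\<^sup>2)"
  unfolding complex_norm_square by (simp flip: cinner_commute)

text \<open>The orthogonal projection \<open>s\<close> of \<psi> satisfies (norm s)^2 =
  \<open>cinner s \<psi>\<close>, so Cauchy-Schwarz gives
  \<open>norm s \<le> norm \<psi>\<close>.\<close>

lemma bessel_finite:
  assumes "orthonormal_family F e" "finite F"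
  shows "(\<Sum>i\<in>F. (norm (cinner \<psi> (e i)))\<^sup>2) \<le> (norm \<psi>)\<^sup>2"
proof -
  define s where "s = (\<Sum>i\<in>F. cinner \<psi> (e i) *\<^sub>C e i)"
  define t where "t = (\<Sum>i\<in>F. (norm (cinner \<psi> (e i)))\<^sup>2)"
  have 1: "cinner s \<psi> = of_real t"
    unfolding s_def t_def cinner_sum_left cinner_scaleC_left cinner_mult_swap of_real_sum ..
  have se: "cinner s (e i) = cinner \<psi> (e i)" if "i \<in> F" for i
  proof -
    have "cinner s (e i) = (\<Sum>j\<in>F. cinner \<psi> (e j) * (if j = i then 1 else 0))"
      unfolding s_def cinner_sum_left cinner_scaleC_left
      by (intro sum.cong refl) (use assms(1) that in \<open>auto simp: orthonormal_family_def\<close>)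
    then show ?thesis using assms(2) that by (simp add: if_distrib cong: if_cong)
  qed
  have "cinner s s = (\<Sum>i\<in>F. cinner \<psi> (e i) * cinner (e i) s)"
    by (subst (1) s_def) (simp add: cinner_sum_left cinner_scaleC_left)
  also have "\<dots> = (\<Sum>i\<in>F. cinner \<psi> (e i) * cinner (e i) \<psi>)"
    using se by (intro sum.cong refl) (metis cinner_commute)
  also have "\<dots> = of_real t"
    unfolding t_def cinner_mult_swap of_real_sum ..
  finally have 2: "(norm s)\<^sup>2 = t"
    unfolding cinner_self of_real_eq_iff .
  have "t = norm (cinner s \<psi>)" by (simp add: 1) (simp add: t_def sum_nonneg)
  also have "\<dots> \<le> norm s * norm \<psi>" by (rule norm_cinner_le)
  finally have "norm s * norm s \<le> norm s * norm \<psi>" using 2 by (simp add: power2_eq_square)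
  then have "norm s \<le> norm \<psi>" by (cases "norm s = 0") auto
  then show ?thesis using 2 unfolding t_def[symmetric] by (metis norm_ge_zero power_mono)
qed

lemma bessel:
  assumes "orthonormal_family I e"
  shows "(\<lambda>i. (norm (cinner \<psi> (e i)))\<^sup>2) summable_on I"
    and "(\<Sum>\<^sub>\<infinity>i\<in>I. (norm (cinner \<psi> (e i)))\<^sup>2) \<le> (norm \<psi>)\<^sup>2"
proof -
  have fin: "(\<Sum>i\<in>F. (norm (cinner \<psi> (e i)))\<^sup>2) \<le> (norm \<psi>)\<^sup>2" if "finite F" "F \<subseteq> I" for F
  proof (intro bessel_finite that)
    show "orthonormal_family F e"
      using assms that(2) unfolding orthonormal_family_def by (meson subsetD)
  qed
  show "(\<lambda>i. (norm (cinner \<psi> (e i)))\<^sup>2) summable_on I"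
    by (rule nonneg_bdd_above_summable_on) (auto intro!: bdd_aboveI2 fin)
  then show "(\<Sum>\<^sub>\<infinity>i\<in>I. (norm (cinner \<psi> (e i)))\<^sup>2) \<le> (norm \<psi>)\<^sup>2"
    by (rule infsum_le_finite_sums) (use fin in auto)
qed

text \<open>The arithmetic-geometric mean inequality reduces this to Bessel's inequality for each
  vector; the cruder right-hand side is enough wherever a finite bound is wanted.\<close>

lemma bessel_product:
  assumes "orthonormal_family I e"
  shows "(\<lambda>i. norm (cinner \<psi> (e i) * cinner (e i) \<phi>)) summable_on I"
    and "(\<Sum>\<^sub>\<infinity>i\<in>I. norm (cinner \<psi> (e i) * cinner (e i) \<phi>)) \<le> ((norm \<psi>)\<^sup>2 + (norm \<phi>)\<^sup>2) / 2"
proof -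
  let ?g = "\<lambda>i. ((norm (cinner \<psi> (e i)))\<^sup>2 + (norm (cinner \<phi> (e i)))\<^sup>2) / 2"
  have g: "?g summable_on I"
    unfolding summable_on_def
    by (rule exI, rule has_sum_divide_const, rule has_sum_add;
        rule has_sum_infsum, rule bessel(1)[OF assms])
  have le: "norm (cinner \<psi> (e i) * cinner (e i) \<phi>) \<le> ?g i" for i
    using sum_squares_bound[of "norm (cinner \<psi> (e i))" "norm (cinner \<phi> (e i))"]
    by (simp add: norm_mult cinner_commute[of \<phi> "e i"])
  show 1: "(\<lambda>i. norm (cinner \<psi> (e i) * cinner (e i) \<phi>)) summable_on I"
    by (rule summable_on_comparison_test[OF g]) (use le in auto)
  have "(\<Sum>\<^sub>\<infinity>i\<in>I. norm (cinner \<psi> (e i) * cinner (e i) \<phi>)) \<le> (\<Sum>\<^sub>\<infinity>i\<in>I. ?g i)"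
    by (rule infsum_mono[OF 1 g le])
  also have "\<dots> = ((\<Sum>\<^sub>\<infinity>i\<in>I. (norm (cinner \<psi> (e i)))\<^sup>2) + (\<Sum>\<^sub>\<infinity>i\<in>I. (norm (cinner \<phi> (e i)))\<^sup>2)) / 2"
    by (intro infsumI has_sum_divide_const has_sum_add has_sum_infsum bessel(1)[OF assms])
  also have "\<dots> \<le> ((norm \<psi>)\<^sup>2 + (norm \<phi>)\<^sup>2) / 2"
    using bessel(2)[OF assms, of \<psi>] bessel(2)[OF assms, of \<phi>] by simp
  finally show "(\<Sum>\<^sub>\<infinity>i\<in>I. norm (cinner \<psi> (e i) * cinner (e i) \<phi>)) \<le> ((norm \<psi>)\<^sup>2 + (norm \<phi>)\<^sup>2) / 2" .
qed

text \<open>The Riesz representative \<open>b\<close> of \<open>\<psi> \<mapsto> \<Sum>\<^sub>e \<langle>\<psi>, e\<rangle> \<langle>e, \<phi>\<rangle>\<close> satisfies \<open>\<phi> - b \<bottom> E\<close>,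
  so that the expansion needs no convergence in \<open>L\<^sup>2\<close>.\<close>

lemma parseval:
  assumes "orthonormal_basis E"
  shows "((\<lambda>e. cinner \<psi> e * cinner e \<phi>) has_sum cinner \<psi> \<phi>) E"
proof -
  have on: "orthonormal_family E (\<lambda>e. e)" using assms by (simp add: orthonormal_basis_def)
  have sm: "(\<lambda>e. cinner \<psi> e * cinner e \<phi>) summable_on E" for \<psi>
    by (rule Infinite_Sum.abs_summable_summable) (rule bessel_product[OF on])
  define L where "L \<psi> = (\<Sum>\<^sub>\<infinity>e\<in>E. cinner \<psi> e * cinner e \<phi>)" for \<psi>
  have scale: "L (c *\<^sub>C x) = c * L x" for c x
    by (simp add: L_def cinner_scaleC_left mult.assoc infsum_cmult_right')
  have bound: "norm (L x) \<le> ((norm x)\<^sup>2 + (norm \<phi>)\<^sup>2) / 2" for x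
    unfolding L_def using norm_infsum_bound[OF bessel_product(1)[OF on]] bessel_product(2)[OF on]
    by (rule order_trans)
  have "\<exists>b. \<forall>x. L x = cinner x b"
  proof (rule clinear_functional_repr)
    fix x y show "L (x + y) = L x + L y"
      by (simp add: L_def cinner_add_left distrib_right infsum_add sm)
  next
    fix x
    show "norm (L x) \<le> (1 + (norm \<phi>)\<^sup>2) / 2 * norm x"
    proof (cases "x = 0")
      case True then show ?thesis by (simp add: L_def)
    next
      case False
      \<comment> \<open>The bound at hand is not homogeneous in x; applied to the normalised vector
        and scaled back it becomes linear.\<close>
      have "norm (L (complex_of_real (1 / norm x) *\<^sub>C x)) \<le> (1 + (norm \<phi>)\<^sup>2) / 2"
        using bound[of "complex_of_real (1 / norm x) *\<^sub>C x"] False by (simp add: norm_scaleC norm_divide)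
      then show ?thesis using False by (simp add: scale norm_mult norm_divide field_simps)
    qed
  qed (rule scale)
  then obtain b where b: "\<And>x. L x = cinner x b" by blast
  have "cinner (\<phi> - b) e = 0" if "e \<in> E" for e
  proof -
    have "L e = (\<Sum>\<^sub>\<infinity>e'\<in>{e}. cinner e e' * cinner e' \<phi>)"
      unfolding L_def
      by (rule infsum_cong_neutral) (use on that in \<open>auto simp: orthonormal_family_def\<close>)
    also have "\<dots> = cinner e \<phi>" using on that by (simp add: orthonormal_family_def)
    finally have "cinner e b = cinner e \<phi>" by (simp add: b)
    then show ?thesis by (metis cinner_commute cinner_minus_left right_minus_eq)
  qed
  then have "\<phi> - b = 0" using assms unfolding orthonormal_basis_def by blast
  then have "L \<psi> = cinner \<psi> \<phi>" by (simp add: b)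
  then show ?thesis using sm[of \<psi>] by (simp add: L_def summable_iff_has_sum_infsum)
qed

section \<open>The trace\<close>

text \<open>Uniqueness uses that some basis exists: without one, every number would meet the
  description of the trace.\<close>

lemma op_trace_eqI:
  assumes "\<And>E. orthonormal_basis E \<Longrightarrow> ((\<lambda>e. cinner (S e) e) has_sum t) E"
  shows "op_trace S = t"
  unfolding op_trace_def
proof (rule the_equality)
  fix t' assume t': "\<forall>E. orthonormal_basis E \<longrightarrow> ((\<lambda>e. cinner (S e) e) has_sum t') E"
  obtain E :: "'a l2 set" where "orthonormal_basis E" using ex_orthonormal_basis by blast
  then show "t' = t" using assms t' has_sum_unique by blast
qed (use assms in blast)

lemma op_trace_rank_one:
  fixes \<xi> \<eta> :: "'a::euclidean_space l2"
  shows "op_trace (rank_one \<xi> \<eta>) = cinner \<xi> \<eta>"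
proof (rule op_trace_eqI)
  fix E :: "'a l2 set" assume "orthonormal_basis E"
  from parseval[OF this, of \<xi> \<eta>]
  show "((\<lambda>e. cinner (rank_one \<xi> \<eta> e) e) has_sum cinner \<xi> \<eta>) E"
    by (simp add: rank_one_def cinner_scaleC_left mult.commute)
qed

lemma trace_class_cinner_expansion:
  fixes \<xi> \<eta> :: "nat \<Rightarrow> 'a::euclidean_space l2"
  assumes "\<forall>\<psi>. ((\<lambda>n. complex_of_real (s n) *\<^sub>C rank_one (\<xi> n) (\<eta> n) \<psi>) has_sum R \<psi>) N"
  shows "((\<lambda>n. of_real (s n) * (cinner \<psi> (\<eta> n) * cinner (\<xi> n) \<phi>)) has_sum cinner (R \<psi>) \<phi>) N"
proof -
  have "bounded_linear (\<lambda>x. cinner x \<phi>)"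
    by (rule bounded_linear_intro[where K="norm \<phi>"])
      (auto simp: cinner_add_left cinner_scaleR_left norm_cinner_le scaleR_conv_of_real)
  from has_sum_bounded_linear[OF this assms[rule_format]]
  show ?thesis by (simp add: rank_one_def cinner_scaleC_left mult_ac)
qed

text \<open>Both sides are iterated sums of one absolutely summable double family
  \<open>a n e\<close>. Summing over n first gives the diagonal entries in the basis; summing over
  the basis first gives, by Parseval, the terms of the left side. The latter do not involve the
  basis, so the trace is independent of it.\<close>

lemma op_trace_compose_cadjoint:
  fixes \<xi> \<eta> :: "nat \<Rightarrow> 'a::euclidean_space l2"
  assumes B: "bounded_clinear B" and R: "bounded_clinear R"
    and s: "\<forall>n\<in>N. 0 < s n" "s summable_on N"
    and on: "orthonormal_family N \<xi>" "orthonormal_family N \<eta>"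
    and sum: "\<forall>\<psi>. ((\<lambda>n. complex_of_real (s n) *\<^sub>C rank_one (\<xi> n) (\<eta> n) \<psi>) has_sum R \<psi>) N"
  shows "((\<lambda>n. of_real (s n) * cinner (B (\<eta> n)) (\<xi> n)) has_sum op_trace (B \<circ> cadjoint R)) N"
proof -
  obtain K where K: "K \<ge> 0" "\<And>x. norm (B x) \<le> K * norm x" using bounded_clinearD(3)[OF B] by blast
  define a where "a n e = of_real (s n) * (cinner (B (\<eta> n)) e * cinner e (\<xi> n))" for n e
  have inner_sum: "((\<lambda>n. a n e) has_sum cinner ((B \<circ> cadjoint R) e) e) N" for e
  proof -
    \<comment> \<open>The given expansion is one of \<open>R\<close>, not of its adjoint; moving
      both operators across the inner product reduces the entry to \<open>R\<close> applied to
      \<open>cadjoint B e\<close>, up to conjugation.\<close>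
    have "cinner ((B \<circ> cadjoint R) e) e = cnj (cinner (R (cadjoint B e)) e)"
      by (simp add: cinner_cadjoint[OF B] cinner_cadjoint'[OF R] flip: cinner_commute)
    moreover have "((\<lambda>n. cnj (of_real (s n) * (cinner (cadjoint B e) (\<eta> n) * cinner (\<xi> n) e)))
        has_sum cnj (cinner (R (cadjoint B e)) e)) N"
      using trace_class_cinner_expansion[OF sum] by (simp only: has_sum_cnj_iff)
    moreover have "cnj (of_real (s n) * (cinner (cadjoint B e) (\<eta> n) * cinner (\<xi> n) e)) = a n e" for n
      by (simp add: a_def cinner_cadjoint[OF B] flip: cinner_commute)
    ultimately show ?thesis by simp
  qed
  define c where "c n = of_real (s n) * cinner (B (\<eta> n)) (\<xi> n)" for n
  have E_sum: "((\<lambda>e. a n e) has_sum c n) E" if "orthonormal_basis E" for n E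
    unfolding a_def c_def by (intro has_sum_cmult_right parseval that)
  have summ: "(\<lambda>x. norm (case x of (n, e) \<Rightarrow> a n e)) summable_on (N \<times> E)" if E: "orthonormal_basis E" for E
    unfolding Infinite_Sum.abs_summable_on_Sigma_iff
  proof (intro conjI ballI)
    have onE: "orthonormal_family E (\<lambda>e. e)" using E by (simp add: orthonormal_basis_def)
    show *: "(\<lambda>e. norm (case (n, e) of (n, e) \<Rightarrow> a n e)) summable_on E" for n
      using bessel_product(1)[OF onE, of "B (\<eta> n)" "\<xi> n"]
      by (simp add: a_def norm_mult[of "of_real _"] summable_on_cmult_right)
    \<comment> \<open>The constant is the right-hand side of \<open>bessel_product\<close> for a
      vector of norm at most \<open>K\<close> and a unit vector.\<close>
    have "norm (\<Sum>\<^sub>\<infinity>e\<in>E. norm (a n e)) \<le> s n * ((K\<^sup>2 + 1) / 2)" if n: "n \<in> N" for n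
    proof -
      have "norm (B (\<eta> n)) \<le> K" using K(2)[of "\<eta> n"] norm_orthonormal[OF on(2) n] by simp
      then have b: "(norm (B (\<eta> n)))\<^sup>2 \<le> K\<^sup>2" by (intro power_mono) auto
      have sn: "s n > 0" using s n by blast
      have "(\<Sum>\<^sub>\<infinity>e\<in>E. norm (a n e)) = s n * (\<Sum>\<^sub>\<infinity>e\<in>E. norm (cinner (B (\<eta> n)) e * cinner e (\<xi> n)))"
        unfolding a_def norm_mult[of "of_real _"] using sn by (simp add: infsum_cmult_right')
      also have "\<dots> \<le> s n * (((norm (B (\<eta> n)))\<^sup>2 + (norm (\<xi> n))\<^sup>2) / 2)"
        using sn by (intro mult_left_mono bessel_product(2)[OF onE]) auto
      also have "\<dots> \<le> s n * ((K\<^sup>2 + 1) / 2)"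
        using sn b norm_orthonormal[OF on(1) n] by (intro mult_left_mono divide_right_mono) auto
      finally show ?thesis by (simp add: infsum_nonneg)
    qed
    then show "(\<lambda>n. norm (\<Sum>\<^sub>\<infinity>e\<in>E. norm (case (n, e) of (n, e) \<Rightarrow> a n e))) summable_on N"
      by (intro summable_on_comparison_test[OF summable_on_cmult_left[OF s(2), of "(K\<^sup>2 + 1) / 2"]]) auto
  qed
  define t where "t E = (\<Sum>\<^sub>\<infinity>(n, e)\<in>N \<times> E. a n e)" for E
  have has_t: "((\<lambda>(n, e). a n e) has_sum t E) (N \<times> E)" if "orthonormal_basis E" for E
    unfolding t_def using Infinite_Sum.abs_summable_summable[OF summ[OF that]] by (simp add: summable_iff_has_sum_infsum)
  have cN: "(c has_sum t E) N" if "orthonormal_basis E" for E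
    using has_sum_SigmaD[OF has_t[OF that], of c] E_sum[OF that] by simp
  have tE: "((\<lambda>e. cinner ((B \<circ> cadjoint R) e) e) has_sum t E) E" if "orthonormal_basis E" for E
  proof -
    have "((\<lambda>(e, n). a n e) has_sum t E) (E \<times> N)"
      using has_t[OF that] by (subst (asm) has_sum_swap) (simp add: case_prod_unfold)
    from has_sum_SigmaD[OF this] inner_sum show ?thesis by simp
  qed
  obtain E0 :: "'a l2 set" where E0: "orthonormal_basis E0" using ex_orthonormal_basis by blast
  have "t E = t E0" if "orthonormal_basis E" for E using cN[OF that] cN[OF E0] has_sum_unique by blast
  then have "op_trace (B \<circ> cadjoint R) = t E0" using tE by (intro op_trace_eqI) metis
  then show ?thesis using cN[OF E0] by (simp add: c_def[abs_def])
qed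


section \<open>An \<open>L\<^sup>2\<close> bound for the Fourier transform\<close>

definition wave :: "real \<Rightarrow> complex" where
  "wave r = exp (2 * of_real pi * \<i> * of_real r)"

lemma norm_wave [simp]: "norm (wave r) = 1"
  by (simp add: wave_def norm_exp_eq_Re)

lemma wave_add: "wave (r + s) = wave r * wave s"
  by (simp add: wave_def exp_add distrib_left)

lemma cnj_wave: "cnj (wave r) = wave (- r)"
  by (simp add: wave_def exp_cnj)

lemma wave_sum: "wave (\<Sum>b\<in>B. g b) = (\<Prod>b\<in>B. wave (g b))"
proof (cases "finite B")
  case True then show ?thesis by (simp add: wave_def sum_distrib_left exp_sum)
qed (simp add: wave_def)

lemma borel_measurable_wave [measurable]: "wave \<in> borel_measurable borel"
  unfolding wave_def by (intro borel_measurable_continuous_onI continuous_intros)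

section \<open>Gaussians and their Fourier transforms\<close>

lemma integrable_gauss_1d:
  assumes "c > 0"
  shows "integrable lborel (\<lambda>w. exp (- (c * w)\<^sup>2 / 2) :: real)"
proof -
  have "integrable lborel (\<lambda>x. sqrt (2 * pi) * std_normal_density x)"
    by (intro integrable_mult_right integrable_normal_density) simp
  then have "integrable lborel (\<lambda>x. exp (- x\<^sup>2 / 2) :: real)"
    by (simp add: std_normal_density_def)
  from lborel_integrable_real_affine[OF this, of c 0] show ?thesis using assms by simp
qed

text \<open>Substituting x = c w leads to the characteristic function of the standard normal law at
  2 pi r / c. The Jacobian contributes 1 / c and the missing normalisation of the density sqrt(2
  pi).\<close>

lemma fourier_gauss_1d:
  assumes "c > 0"
  shows "(\<integral>w. wave (r * w) * of_real (exp (- (c * w)\<^sup>2 / 2)) \<partial>lborel)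
    = of_real (sqrt (2 * pi) / c * exp (- (2 * pi * r / c)\<^sup>2 / 2))"
proof -
  define t where "t = 2 * pi * r / c"
  have "(\<integral>w. wave (r * w) * of_real (exp (- (c * w)\<^sup>2 / 2)) \<partial>lborel)
     = (1 / c) *\<^sub>R (\<integral>x. wave (r * (0 + (1 / c) * x)) * of_real (exp (- (c * (0 + (1 / c) * x))\<^sup>2 / 2)) \<partial>lborel)"
    using assms by (subst lborel_integral_real_affine[where c="1/c" and t=0]) auto
  also have "(\<integral>x. wave (r * (0 + (1 / c) * x)) * of_real (exp (- (c * (0 + (1 / c) * x))\<^sup>2 / 2)) \<partial>lborel)
     = (\<integral>x. of_real (sqrt (2 * pi)) * (std_normal_density x *\<^sub>R iexp (t * x)) \<partial>lborel)"
  proof (rule Bochner_Integration.integral_cong[OF refl])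
    fix x
    have "wave (r * (0 + (1 / c) * x)) = iexp (t * x)"
      by (simp add: wave_def t_def mult_ac)
    then show "wave (r * (0 + (1 / c) * x)) * of_real (exp (- (c * (0 + (1 / c) * x))\<^sup>2 / 2))
      = of_real (sqrt (2 * pi)) * (std_normal_density x *\<^sub>R iexp (t * x))"
      using assms by (simp add: std_normal_density_def scaleR_conv_of_real)
  qed
  also have "\<dots> = of_real (sqrt (2 * pi)) * (\<integral>x. std_normal_density x *\<^sub>R iexp (t * x) \<partial>lborel)"
    by (rule integral_mult_right_zero)
  also have "(\<integral>x. std_normal_density x *\<^sub>R iexp (t * x) \<partial>lborel) = char std_normal_distribution t"
    unfolding char_def by (subst integral_density) auto
  also have "of_real (sqrt (2 * pi)) * char std_normal_distribution t
      = of_real (sqrt (2 * pi) * exp (- t\<^sup>2 / 2))"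
    by (simp add: char_std_normal_distribution)
  finally show ?thesis by (simp add: t_def scaleR_conv_of_real)
qed

text \<open>Lebesgue measure is the image of the product of its one-dimensional copies under the
  coordinate map, so functions of separated coordinates integrate factor by factor.\<close>

lemma has_bochner_integral_lborel_prod:
  fixes f :: "'a::euclidean_space \<Rightarrow> real \<Rightarrow> 'b::{real_normed_field,banach,second_countable_topology}"
  assumes f: "\<And>b. b \<in> Basis \<Longrightarrow> integrable lborel (f b)"
  shows "has_bochner_integral lborel (\<lambda>x. \<Prod>b\<in>Basis. f b (x \<bullet> b)) (\<Prod>b\<in>Basis. \<integral>x. f b x \<partial>lborel)"
proof -
  have [measurable]: "f b \<in> borel_measurable borel" if "b \<in> Basis" for b using f[OF that] by auto
  interpret product_sigma_finite "\<lambda>b::'a. lborel :: real measure" ..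
  have D: "(lborel :: 'a measure) = distr (\<Pi>\<^sub>M b\<in>Basis. lborel) borel (\<lambda>x. \<Sum>b\<in>Basis. x b *\<^sub>R b)"
    by (subst lborel_def) (simp add: lborel_eq_real)
  show ?thesis
    unfolding has_bochner_integral_iff D
    using product_integrable_prod[OF finite_Basis f] product_integral_prod[OF finite_Basis f]
    by (simp add: integrable_distr_eq integral_distr)
qed

text \<open>This is exp(- c^2 |w|^2 / 2), written as a product so that integrals reduce to one
  dimension.\<close>

definition gauss :: "real \<Rightarrow> 'a::euclidean_space \<Rightarrow> real" where
  "gauss c w = (\<Prod>b\<in>Basis. exp (- (c * (w \<bullet> b))\<^sup>2 / 2))"

text \<open>The density of the centred normal law with standard deviation c / (2 pi) in each
  coordinate.\<close>

definition gauss_hat :: "real \<Rightarrow> 'a::euclidean_space \<Rightarrow> real" where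
  "gauss_hat c u = (\<Prod>b\<in>Basis. sqrt (2 * pi) / c * exp (- (2 * pi * (u \<bullet> b) / c)\<^sup>2 / 2))"

lemma borel_measurable_gauss [measurable]: "gauss c \<in> borel_measurable borel"
  unfolding gauss_def by measurable

lemma borel_measurable_gauss_hat [measurable]: "gauss_hat c \<in> borel_measurable borel"
  unfolding gauss_hat_def by measurable

lemma gauss_nonneg: "0 \<le> gauss c w"
  unfolding gauss_def by (intro prod_nonneg) auto

lemma gauss_hat_nonneg: "c > 0 \<Longrightarrow> 0 \<le> gauss_hat c u"
  unfolding gauss_hat_def by (intro prod_nonneg) auto

lemma integrable_gauss:
  assumes "c > 0" shows "integrable lborel (gauss c :: 'a::euclidean_space \<Rightarrow> real)"
  using has_bochner_integral_lborel_prod[of "\<lambda>b w. exp (- (c * w)\<^sup>2 / 2)"] integrable_gauss_1d[OF assms]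
  unfolding gauss_def has_bochner_integral_iff by blast

lemma fourier_gauss:
  fixes u :: "'a::euclidean_space"
  assumes c: "c > 0"
  shows "(\<integral>w. wave (w \<bullet> u) * of_real (gauss c w) \<partial>lborel) = of_real (gauss_hat c u)"
proof -
  have int: "integrable lborel (\<lambda>w. wave ((u \<bullet> b) * w) * of_real (exp (- (c * w)\<^sup>2 / 2)))" for b
    by (rule Bochner_Integration.integrable_bound[OF integrable_gauss_1d[OF c]]) (auto simp: norm_mult)
  have "wave (w \<bullet> u) * of_real (gauss c w) =
      (\<Prod>b\<in>Basis. wave ((u \<bullet> b) * (w \<bullet> b)) * of_real (exp (- (c * (w \<bullet> b))\<^sup>2 / 2)))" for w
    unfolding euclidean_inner[of w u] wave_sum gauss_def of_real_prod prod.distrib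
    by (simp add: mult.commute)
  then have "(\<integral>w. wave (w \<bullet> u) * of_real (gauss c w) \<partial>lborel)
    = (\<Prod>b\<in>Basis. \<integral>w. wave ((u \<bullet> b) * w) * of_real (exp (- (c * w)\<^sup>2 / 2)) \<partial>lborel)"
    using has_bochner_integral_integral_eq[OF has_bochner_integral_lborel_prod[OF int, of "\<lambda>b. b"]]
    by (simp only:)
  then show ?thesis
    by (simp only: fourier_gauss_1d[OF c] gauss_hat_def of_real_prod)
qed

text \<open>Each factor is again a Gaussian, with parameter 2 pi / c; its integral is the
  one-dimensional transform at frequency 0, and the two normalising constants multiply to 1.\<close>

lemma nn_integral_gauss_hat:
  assumes c: "c > 0"
  shows "(\<integral>\<^sup>+u. gauss_hat c (u::'a::euclidean_space) \<partial>lborel) = 1"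
proof -
  define f :: "real \<Rightarrow> real" where "f x = sqrt (2 * pi) / c * exp (- (2 * pi * x / c)\<^sup>2 / 2)" for x
  have c': "2 * pi / c > 0" using c by simp
  have int: "integrable lborel f"
    using integrable_mult_right[OF integrable_gauss_1d[OF c'], of "sqrt (2 * pi) / c"]
    unfolding f_def by (simp add: mult.assoc)
  have "complex_of_real (\<integral>x. exp (- (2 * pi / c * x)\<^sup>2 / 2) \<partial>lborel) = of_real (sqrt (2 * pi) / (2 * pi / c))"
    using fourier_gauss_1d[OF c', of 0]
    by (simp add: wave_def del: of_real_divide of_real_exp flip: integral_complex_of_real)
  then have "(\<integral>x. exp (- (2 * pi / c * x)\<^sup>2 / 2) \<partial>lborel) = sqrt (2 * pi) / (2 * pi / c)"
    using of_real_eq_iff by blast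
  moreover have "sqrt (2 * pi) / c * (sqrt (2 * pi) / (2 * pi / c)) = 1"
    using c by (simp add: field_simps flip: real_sqrt_mult)
  moreover have "f x = sqrt (2 * pi) / c * exp (- (2 * pi / c * x)\<^sup>2 / 2)" for x
    by (simp add: f_def)
  ultimately have 1: "(\<integral>x. f x \<partial>lborel) = 1" by (simp only: integral_mult_right_zero)
  have eq: "gauss_hat c = (\<lambda>u::'a. \<Prod>b\<in>Basis. f (u \<bullet> b))"
    by (simp only: gauss_hat_def f_def fun_eq_iff simp_thms)
  from has_bochner_integral_lborel_prod[of "\<lambda>b. f"] int 1
  have "has_bochner_integral lborel (gauss_hat c :: 'a \<Rightarrow> real) 1"
    by (simp add: eq)
  then show ?thesis using gauss_hat_nonneg[OF c, where 'a='a]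
    by (simp add: has_bochner_integral_iff nn_integral_eq_integral)
qed

lemma gauss_tendsto: "(\<lambda>n. gauss (1 / real (Suc n)) w) \<longlonglongrightarrow> 1"
proof -
  have "(\<lambda>n. gauss (1 / real (Suc n)) w) \<longlonglongrightarrow> (\<Prod>b\<in>(Basis::'a set). exp (- (0 * (w \<bullet> b))\<^sup>2 / 2))"
    unfolding gauss_def by (intro tendsto_intros LIMSEQ_Suc[OF lim_1_over_n]) auto
  then show ?thesis by simp
qed

text \<open>Justifies the exchanges of integrals below, with \<open>k\<close> the oscillating
  factor.\<close>

lemma integrable_pair_mult:
  fixes f g :: "_ \<Rightarrow> complex"
  assumes f: "integrable (lborel :: 'a::euclidean_space measure) f"
    and g: "integrable (lborel :: 'b::euclidean_space measure) g"
    and k [measurable]: "case_prod k \<in> borel_measurable (borel \<Otimes>\<^sub>M borel)"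
    and 1: "\<And>x y. norm (k x y) \<le> 1"
  shows "integrable (lborel \<Otimes>\<^sub>M lborel) (\<lambda>(x, y). f x * g y * k x y)"
proof -
  have [measurable]: "f \<in> borel_measurable borel" "g \<in> borel_measurable borel" using f g by auto
  have "integrable (lborel \<Otimes>\<^sub>M lborel) (\<lambda>(x, y). f x * g y)"
  proof (rule lborel_pair.Fubini_integrable)
    show "integrable lborel (\<lambda>x. \<integral>y. norm (case (x, y) of (x, y) \<Rightarrow> f x * g y) \<partial>lborel)"
      using f by (simp add: norm_mult)
  qed (use g in auto)
  then show ?thesis
    by (rule Bochner_Integration.integrable_bound)
      (use mult_left_mono[OF 1] in \<open>auto simp: norm_mult\<close>)
qed

lemma nn_integral_lborel_translate:
  fixes f :: "'a::euclidean_space \<Rightarrow> ennreal"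
  assumes [measurable]: "f \<in> borel_measurable borel"
  shows "(\<integral>\<^sup>+x. f (x - a) \<partial>lborel) = (\<integral>\<^sup>+x. f x \<partial>lborel)"
    and "(\<integral>\<^sup>+x. f (a - x) \<partial>lborel) = (\<integral>\<^sup>+x. f x \<partial>lborel)"
proof -
  have "(\<integral>\<^sup>+x. f x \<partial>lborel) = (\<integral>\<^sup>+x. f x \<partial>distr lborel borel ((+) (- a)))"
    by (simp add: lborel_distr_plus)
  also have "\<dots> = (\<integral>\<^sup>+x. f (x - a) \<partial>lborel)" by (subst nn_integral_distr) auto
  finally show "(\<integral>\<^sup>+x. f (x - a) \<partial>lborel) = (\<integral>\<^sup>+x. f x \<partial>lborel)" ..
  have "(\<integral>\<^sup>+x. f x \<partial>lborel) = (\<integral>\<^sup>+x. f x \<partial>distr lborel borel ((+) a))"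
    by (simp add: lborel_distr_plus)
  also have "\<dots> = (\<integral>\<^sup>+x. f (a + x) \<partial>lborel)" by (subst nn_integral_distr) auto
  also have "\<dots> = (\<integral>\<^sup>+x. f (a + x) \<partial>distr lborel borel uminus)"
    using lborel_distr_reflect[where 'a='a] by simp
  also have "\<dots> = (\<integral>\<^sup>+x. f (a - x) \<partial>lborel)" by (subst nn_integral_distr) auto
  finally show "(\<integral>\<^sup>+x. f (a - x) \<partial>lborel) = (\<integral>\<^sup>+x. f x \<partial>lborel)" ..
qed

text \<open>Bound \<open>g s * g t\<close> by half the sum of the squares. In each half one variable
  occurs only in the kernel, which has mass one in either variable, so each half contributes half of
  the right-hand side.\<close>

lemma nn_integral_gauss_hat_convolution:
  fixes g :: "'a::euclidean_space \<Rightarrow> real"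
  assumes [measurable]: "g \<in> borel_measurable borel" and c: "c > 0" and nn: "\<And>x. 0 \<le> g x"
  shows "(\<integral>\<^sup>+s. \<integral>\<^sup>+t. ennreal (g s * g t * gauss_hat c (t - s)) \<partial>lborel \<partial>lborel)
    \<le> (\<integral>\<^sup>+t. ennreal ((g t)\<^sup>2) \<partial>lborel)"
proof -
  let ?k = "\<lambda>s t. ennreal (gauss_hat c (t - s))"
  let ?I = "\<integral>\<^sup>+t. ennreal ((g t)\<^sup>2) \<partial>lborel"
  obtain h :: real where h: "h \<ge> 0" "h = 1/2" by (rule that[of "1/2"]) auto
  have le: "ennreal (g s * g t * gauss_hat c (t - s)) \<le>
    ennreal h * (ennreal ((g s)\<^sup>2) * ?k s t + ennreal ((g t)\<^sup>2) * ?k s t)" for s t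
  proof -
    have "g s * g t * gauss_hat c (t - s) \<le> (((g s)\<^sup>2 + (g t)\<^sup>2) / 2) * gauss_hat c (t - s)"
      using sum_squares_bound[of "g s" "g t"] by (intro mult_right_mono gauss_hat_nonneg c) simp
    also have "\<dots> = h * ((g s)\<^sup>2 * gauss_hat c (t - s) + (g t)\<^sup>2 * gauss_hat c (t - s))"
      by (simp add: h(2) field_simps)
    finally show ?thesis
      using gauss_hat_nonneg[OF c, of "t - s"] h(1)
      by (simp add: ennreal_leI flip: ennreal_mult ennreal_plus)
  qed
  have 1: "(\<integral>\<^sup>+s. \<integral>\<^sup>+t. ennreal ((g s)\<^sup>2) * ?k s t \<partial>lborel \<partial>lborel) = ?I"
    using nn_integral_lborel_translate(1)[of "\<lambda>t::'a. ennreal (gauss_hat c t)"] nn_integral_gauss_hat[OF c, where 'a='a]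
    by (simp add: nn_integral_cmult)
  have "(\<integral>\<^sup>+s. \<integral>\<^sup>+t. ennreal ((g t)\<^sup>2) * ?k s t \<partial>lborel \<partial>lborel)
     = (\<integral>\<^sup>+t. \<integral>\<^sup>+s. ennreal ((g t)\<^sup>2) * ?k s t \<partial>lborel \<partial>lborel)"
    by (rule lborel_pair.Fubini') measurable
  also have "\<dots> = ?I"
    using nn_integral_lborel_translate(2)[of "\<lambda>t::'a. ennreal (gauss_hat c t)"] nn_integral_gauss_hat[OF c, where 'a='a]
    by (simp add: nn_integral_cmult)
  finally have 2: "(\<integral>\<^sup>+s. \<integral>\<^sup>+t. ennreal ((g t)\<^sup>2) * ?k s t \<partial>lborel \<partial>lborel) = ?I" .
  have "(\<integral>\<^sup>+s. \<integral>\<^sup>+t. ennreal (g s * g t * gauss_hat c (t - s)) \<partial>lborel \<partial>lborel)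
    \<le> (\<integral>\<^sup>+s. \<integral>\<^sup>+t. ennreal h * (ennreal ((g s)\<^sup>2) * ?k s t + ennreal ((g t)\<^sup>2) * ?k s t) \<partial>lborel \<partial>lborel)"
    by (intro nn_integral_mono le)
  also have "\<dots> = ennreal h * ((\<integral>\<^sup>+s. \<integral>\<^sup>+t. ennreal ((g s)\<^sup>2) * ?k s t \<partial>lborel \<partial>lborel)
      + (\<integral>\<^sup>+s. \<integral>\<^sup>+t. ennreal ((g t)\<^sup>2) * ?k s t \<partial>lborel \<partial>lborel))"
    by (simp add: nn_integral_cmult nn_integral_add)
  also have "\<dots> = ennreal h * (ennreal 2 * ?I)" unfolding 1 2 by (simp add: mult_2)
  also have "\<dots> = ?I"
  proof -
    have "ennreal h * ennreal 2 = ennreal (h * 2)" using h by (intro ennreal_mult[symmetric]) auto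
    also have "h * 2 = 1" using h by simp
    finally show ?thesis by (simp add: mult.assoc[symmetric])
  qed
  finally show ?thesis .
qed

section \<open>The Fourier transform as a contraction\<close>

definition fourier :: "('a::euclidean_space \<Rightarrow> complex) \<Rightarrow> 'a \<Rightarrow> complex" where
  "fourier g w = (\<integral>t. g t * wave (- (w \<bullet> t)) \<partial>lborel)"

lemma borel_measurable_fourier [measurable]:
  assumes [measurable]: "g \<in> borel_measurable borel"
  shows "fourier g \<in> borel_measurable borel"
  unfolding fourier_def by measurable

lemma norm_fourier_le: "norm (fourier g w) \<le> (\<integral>t. norm (g t) \<partial>lborel)"
  unfolding fourier_def
  using integral_norm_bound[of lborel "\<lambda>t. g t * wave (- (w \<bullet> t))"] by (simp add: norm_mult)

text \<open>A non-integrable function has integral zero by convention, so the estimate can be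
  applied before integrability is known.\<close>

lemma norm_integral_le_nn_integral:
  fixes f :: "'a \<Rightarrow> 'b::{banach, second_countable_topology}"
  shows "ennreal (norm (integral\<^sup>L M f)) \<le> (\<integral>\<^sup>+x. norm (f x) \<partial>M)"
  by (cases "integrable M f") (auto simp: integral_norm_bound_ennreal not_integrable_integral_eq)

text \<open>Writing the squared modulus as a product with a conjugate and unfolding both transforms
  gives the double integral of g(s) cnj(g(t)) against \<open>gauss_hat c (t - s)\<close>. The
  transform of an integrable function is merely bounded, so it is the weight that makes the
  exchanges of integrals legitimate.\<close>

lemma fourier_gauss_weighted:
  fixes g :: "'a::euclidean_space \<Rightarrow> complex"
  assumes g: "integrable lborel g" and c: "c > 0"
  shows "(\<integral>\<^sup>+w. ennreal (gauss c w * (norm (fourier g w))\<^sup>2) \<partial>lborel) \<le> (\<integral>\<^sup>+t. ennreal ((norm (g t))\<^sup>2) \<partial>lborel)"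
proof -
  have [measurable]: "g \<in> borel_measurable borel" using g by auto
  define M where "M = (\<integral>t. norm (g t) \<partial>lborel)"
  have M: "norm (fourier g w) \<le> M" for w unfolding M_def by (rule norm_fourier_le)
  have M0: "0 \<le> M" by (simp add: M_def)
  have G: "integrable lborel (\<lambda>w::'a. complex_of_real (gauss c w))"
    using integrable_gauss[OF c, where 'a='a] by simp
  have gc: "integrable lborel (\<lambda>t. cnj (g t))" using g by simp
  have GF: "integrable lborel (\<lambda>w. gauss c w * cnj (fourier g w))"
  proof (rule Bochner_Integration.integrable_bound[OF integrable_mult_right[OF G, of "of_real M"]])
    show "AE w in lborel. norm (gauss c w * cnj (fourier g w)) \<le> norm (of_real M * complex_of_real (gauss c w))"
      using mult_left_mono[OF M gauss_nonneg] M0 by (auto simp: norm_mult gauss_nonneg mult.commute)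
  qed measurable
  \<comment> \<open>\<open>H\<close> is what remains when only the unconjugated transform is opened;
    opening the other one shows it to be a convolution.\<close>
  define H where "H s = (\<integral>w. gauss c w * cnj (fourier g w) * wave (- (w \<bullet> s)) \<partial>lborel)" for s
  have H: "H s = (\<integral>t. cnj (g t) * of_real (gauss_hat c (t - s)) \<partial>lborel)" for s
  proof -
    have "H s = (\<integral>w. \<integral>t. complex_of_real (gauss c w) * cnj (g t) * wave (w \<bullet> (t - s)) \<partial>lborel \<partial>lborel)"
      unfolding H_def
    proof (rule Bochner_Integration.integral_cong[OF refl])
      fix w
      have "cnj (fourier g w) = (\<integral>t. cnj (g t) * wave (w \<bullet> t) \<partial>lborel)"
        by (simp add: fourier_def cnj_wave flip: Bochner_Integration.integral_cnj)
      then have "gauss c w * cnj (fourier g w) * wave (- (w \<bullet> s))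
        = (\<integral>t. (gauss c w * wave (- (w \<bullet> s))) * (cnj (g t) * wave (w \<bullet> t)) \<partial>lborel)"
        by simp
      also have "\<dots> = (\<integral>t. complex_of_real (gauss c w) * cnj (g t) * wave (w \<bullet> (t - s)) \<partial>lborel)"
        using wave_add[of "w \<bullet> t" "- (w \<bullet> s)" for t] by (simp add: inner_diff_right mult_ac)
      finally show "gauss c w * cnj (fourier g w) * wave (- (w \<bullet> s))
        = (\<integral>t. complex_of_real (gauss c w) * cnj (g t) * wave (w \<bullet> (t - s)) \<partial>lborel)" .
    qed
    also have "\<dots> = (\<integral>t. \<integral>w. complex_of_real (gauss c w) * cnj (g t) * wave (w \<bullet> (t - s)) \<partial>lborel \<partial>lborel)"
      by (rule lborel_pair.Fubini_integral[symmetric]) (rule integrable_pair_mult[OF G gc], auto)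
    also have "\<dots> = (\<integral>t. cnj (g t) * of_real (gauss_hat c (t - s)) \<partial>lborel)"
    proof (rule Bochner_Integration.integral_cong[OF refl])
      fix t
      have "(\<integral>w. complex_of_real (gauss c w) * cnj (g t) * wave (w \<bullet> (t - s)) \<partial>lborel)
        = (\<integral>w. cnj (g t) * (wave (w \<bullet> (t - s)) * of_real (gauss c w)) \<partial>lborel)"
        by (simp add: mult_ac)
      then show "(\<integral>w. complex_of_real (gauss c w) * cnj (g t) * wave (w \<bullet> (t - s)) \<partial>lborel)
        = cnj (g t) * of_real (gauss_hat c (t - s))"
        by (simp add: fourier_gauss[OF c])
    qed
    finally show ?thesis .
  qed
  have "(\<integral>w. gauss c w * (norm (fourier g w))\<^sup>2 \<partial>lborel) = (\<integral>s. g s * H s \<partial>lborel)" (is "complex_of_real ?I = _")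
  proof -
    have "complex_of_real ?I = (\<integral>w. gauss c w * cnj (fourier g w) * fourier g w \<partial>lborel)"
      unfolding integral_complex_of_real[symmetric] of_real_mult complex_norm_square
      by (simp add: mult_ac)
    also have "\<dots> = (\<integral>w. \<integral>s. gauss c w * cnj (fourier g w) * g s * wave (- (w \<bullet> s)) \<partial>lborel \<partial>lborel)"
      by (subst (2) fourier_def) (simp add: mult.assoc)
    also have "\<dots> = (\<integral>s. \<integral>w. gauss c w * cnj (fourier g w) * g s * wave (- (w \<bullet> s)) \<partial>lborel \<partial>lborel)"
      by (rule lborel_pair.Fubini_integral[symmetric]) (rule integrable_pair_mult[OF GF g], auto)
    also have "\<dots> = (\<integral>s. \<integral>w. g s * (gauss c w * cnj (fourier g w) * wave (- (w \<bullet> s))) \<partial>lborel \<partial>lborel)"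
      by (simp add: mult_ac)
    also have "\<dots> = (\<integral>s. g s * H s \<partial>lborel)" by (simp add: H_def)
    finally show ?thesis .
  qed
  note key = this
  have I0: "0 \<le> gauss c w * (norm (fourier g w))\<^sup>2" for w by (simp add: gauss_nonneg)
  have "integrable lborel (\<lambda>w. gauss c w * (norm (fourier g w))\<^sup>2)"
  proof (rule Bochner_Integration.integrable_bound[OF integrable_mult_right[OF integrable_gauss[OF c], of "M\<^sup>2"]])
    show "AE w in lborel. norm (gauss c w * (norm (fourier g w))\<^sup>2) \<le> norm (M\<^sup>2 * gauss c w)"
    proof (rule AE_I2)
      fix w
      have "gauss c w * (norm (fourier g w))\<^sup>2 \<le> gauss c w * M\<^sup>2"
        by (intro mult_left_mono power_mono M norm_ge_zero gauss_nonneg)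
      then show "norm (gauss c w * (norm (fourier g w))\<^sup>2) \<le> norm (M\<^sup>2 * gauss c w)"
        by (simp add: gauss_nonneg mult.commute abs_mult)
    qed
  qed measurable
  \<comment> \<open>The left side is finite and nonnegative, hence the modulus of the complex
    integral in \<open>key\<close>; absolute values may now be moved inside.\<close>
  then have "(\<integral>\<^sup>+w. ennreal (gauss c w * (norm (fourier g w))\<^sup>2) \<partial>lborel)
      = ennreal (norm (\<integral>s. g s * H s \<partial>lborel))"
    unfolding key[symmetric] norm_of_real abs_of_nonneg[OF integral_nonneg_AE[OF AE_I2[OF I0]]]
    by (rule nn_integral_eq_integral) (use I0 in simp)
  also have "\<dots> \<le> (\<integral>\<^sup>+s. norm (g s * H s) \<partial>lborel)"
    by (rule norm_integral_le_nn_integral)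
  also have "\<dots> \<le> (\<integral>\<^sup>+s. \<integral>\<^sup>+t. ennreal (norm (g s) * norm (g t) * gauss_hat c (t - s)) \<partial>lborel \<partial>lborel)"
  proof (rule nn_integral_mono)
    fix s
    have "ennreal (norm (H s)) \<le> (\<integral>\<^sup>+t. ennreal (norm (g t) * gauss_hat c (t - s)) \<partial>lborel)"
      unfolding H using norm_integral_le_nn_integral[of lborel "\<lambda>t. cnj (g t) * of_real (gauss_hat c (t - s))"]
      by (simp add: norm_mult gauss_hat_nonneg[OF c])
    then have "ennreal (norm (g s)) * ennreal (norm (H s))
        \<le> ennreal (norm (g s)) * (\<integral>\<^sup>+t. ennreal (norm (g t) * gauss_hat c (t - s)) \<partial>lborel)"
      by (rule mult_left_mono) simp
    also have "\<dots> = (\<integral>\<^sup>+t. ennreal (norm (g s) * norm (g t) * gauss_hat c (t - s)) \<partial>lborel)"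
      by (simp add: mult.assoc gauss_hat_nonneg[OF c] ennreal_mult nn_integral_cmult)
    finally show "ennreal (norm (g s * H s)) \<le> \<dots>" by (simp add: norm_mult ennreal_mult)
  qed
  also have "\<dots> \<le> (\<integral>\<^sup>+t. ennreal ((norm (g t))\<^sup>2) \<partial>lborel)"
    by (rule nn_integral_gauss_hat_convolution) (use c in auto)
  finally show ?thesis .
qed

lemma fourier_L2_le:
  fixes g :: "'a::euclidean_space \<Rightarrow> complex"
  assumes g: "integrable lborel g"
  shows "(\<integral>\<^sup>+w. ennreal ((norm (fourier g w))\<^sup>2) \<partial>lborel) \<le> (\<integral>\<^sup>+t. ennreal ((norm (g t))\<^sup>2) \<partial>lborel)"
proof -
  have [measurable]: "g \<in> borel_measurable borel" using g by auto
  \<comment> \<open>The parameter 1 / (n + 1) is positive from n = 0 on and tends to 0, so the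
    weights tend to 1 pointwise.\<close>
  let ?f = "\<lambda>n w. ennreal (gauss (1 / real (Suc n)) w * (norm (fourier g w))\<^sup>2)"
  have lim: "ennreal ((norm (fourier g w))\<^sup>2) = liminf (\<lambda>n. ?f n w)" for w
  proof -
    have "(\<lambda>n. ?f n w) \<longlonglongrightarrow> ennreal (1 * (norm (fourier g w))\<^sup>2)"
      by (intro tendsto_ennrealI tendsto_mult gauss_tendsto tendsto_const)
    from lim_imp_Liminf[OF _ this] show ?thesis by simp
  qed
  have "(\<integral>\<^sup>+w. ennreal ((norm (fourier g w))\<^sup>2) \<partial>lborel) \<le> liminf (\<lambda>n. \<integral>\<^sup>+w. ?f n w \<partial>lborel)"
    unfolding lim by (rule nn_integral_liminf) measurable
  also have "\<dots> \<le> limsup (\<lambda>n. \<integral>\<^sup>+w. ?f n w \<partial>lborel)"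
    by (rule Liminf_le_Limsup) simp
  also have "\<dots> \<le> (\<integral>\<^sup>+t. ennreal ((norm (g t))\<^sup>2) \<partial>lborel)"
    by (rule Limsup_bounded) (intro always_eventually allI fourier_gauss_weighted[OF g], simp)
  finally show ?thesis .
qed


section \<open>Time-frequency shifts and localization operators\<close>

lemma tf_shift_abs:
  assumes "square_integrable f"
  shows "tf_shift (x, w) (abs_l2 f) = abs_l2 (\<lambda>t. wave (w \<bullet> t) * f (t - x))"
  using assms by (simp add: tf_shift.abs_eq l2_rel_refl wave_def)

lemma square_integrable_tf_shift:
  assumes f: "square_integrable f"
  shows "square_integrable (\<lambda>t. wave (w \<bullet> t) * f (t - x))"
  using square_integrable_translate[OF f, of x]
  by (auto simp: square_integrable_def norm_mult)

lemma cinner_tf_shift: "cinner (tf_shift z \<psi>) (tf_shift z \<phi>) = cinner \<psi> \<phi>"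
proof -
  obtain x w where z: "z = (x, w)" by (cases z)
  obtain f where f: "square_integrable f" "\<psi> = abs_l2 f" by (rule l2_cases)
  obtain g where g: "square_integrable g" "\<phi> = abs_l2 g" by (rule l2_cases)
  have [measurable]: "f \<in> borel_measurable borel" "g \<in> borel_measurable borel"
    using f g by (auto simp: square_integrable_def)
  have "cinner (tf_shift z \<psi>) (tf_shift z \<phi>) = (\<integral>t. f (t - x) * cnj (g (t - x)) \<partial>lborel)"
  proof -
    have "wave (w \<bullet> t) * f (t - x) * cnj (wave (w \<bullet> t) * g (t - x)) = f (t - x) * cnj (g (t - x))" for t
    proof -
      have "wave (w \<bullet> t) * cnj (wave (w \<bullet> t)) = 1" by (simp flip: complex_norm_square)
      then have "(wave (w \<bullet> t) * cnj (wave (w \<bullet> t))) * (f (t - x) * cnj (g (t - x))) = f (t - x) * cnj (g (t - x))"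
        by simp
      then show ?thesis by (simp only: complex_cnj_mult mult_ac)
    qed
    then show ?thesis
      by (simp only: z f g tf_shift_abs cinner_abs square_integrable_tf_shift)
  qed
  also have "\<dots> = (\<integral>t. f t * cnj (g t) \<partial>distr lborel borel ((+) (- x)))"
    by (subst integral_distr) auto
  also have "\<dots> = cinner \<psi> \<phi>" by (simp add: lborel_distr_plus f g cinner_abs)
  finally show ?thesis .
qed

lemma tf_shift_add: "tf_shift z (a + b) = tf_shift z a + tf_shift z b"
proof -
  obtain x w where z: "z = (x, w)" by (cases z)
  obtain f where f: "square_integrable f" "a = abs_l2 f" by (rule l2_cases)
  obtain g where g: "square_integrable g" "b = abs_l2 g" by (rule l2_cases)
  show ?thesis
    using square_integrable_tf_shift[OF f(1)] square_integrable_tf_shift[OF g(1)] f g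
    by (simp add: z plus_l2.abs_eq tf_shift_abs square_integrable_add l2_rel_refl distrib_left)
qed

lemma tf_shift_scaleC: "tf_shift z (c *\<^sub>C a) = c *\<^sub>C tf_shift z a"
proof -
  obtain x w where z: "z = (x, w)" by (cases z)
  obtain f where f: "square_integrable f" "a = abs_l2 f" by (rule l2_cases)
  show ?thesis
    using square_integrable_tf_shift[OF f(1)] f
    by (simp add: z scaleC.abs_eq tf_shift_abs square_integrable_scale l2_rel_refl mult.left_commute)
qed

lemma norm_tf_shift: "norm (tf_shift z a) = norm a"
  by (simp add: norm_eq_sqrt_inner inner_l2_def cinner_tf_shift)

lemma bounded_clinear_tf_shift: "bounded_clinear (tf_shift z)"
  by (rule bounded_clinearI[where K=1]) (simp_all add: tf_shift_add tf_shift_scaleC norm_tf_shift)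

lemma reflect_abs: "square_integrable f \<Longrightarrow> reflect (abs_l2 f) = abs_l2 (\<lambda>t. f (- t))"
  by (simp add: reflect.abs_eq l2_rel_refl)

lemma reflect_reflect [simp]: "reflect (reflect a) = a"
  by (rule l2_cases[of a]) (simp add: reflect_abs square_integrable_reflect)

lemma reflect_scaleC: "reflect (c *\<^sub>C a) = c *\<^sub>C reflect a"
  by (rule l2_cases[of a])
    (simp add: scaleC.abs_eq reflect_abs square_integrable_scale square_integrable_reflect l2_rel_refl)

lemma cinner_reflect: "cinner (reflect a) b = cinner a (reflect b)"
proof -
  obtain f where f: "square_integrable f" "a = abs_l2 f" by (rule l2_cases)
  obtain g where g: "square_integrable g" "b = abs_l2 g" by (rule l2_cases)
  have [measurable]: "f \<in> borel_measurable borel" "g \<in> borel_measurable borel"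
    using f g by (auto simp: square_integrable_def)
  have "cinner (reflect a) b = (\<integral>t. f (- t) * cnj (g t) \<partial>distr lborel borel uminus)"
    using lborel_distr_reflect[where 'a='a]
    by (simp add: f g reflect_abs cinner_abs square_integrable_reflect)
  also have "\<dots> = cinner a (reflect b)"
    by (subst integral_distr) (auto simp: f g reflect_abs cinner_abs square_integrable_reflect)
  finally show ?thesis .
qed

lemma op_reflect_rank_one: "op_reflect (rank_one \<xi> \<eta>) = rank_one (reflect \<xi>) (reflect \<eta>)"
  by (simp add: op_reflect_def rank_one_def fun_eq_iff reflect_scaleC cinner_reflect)

lemma op_shift_rank_one: "op_shift z (rank_one \<xi> \<eta>) = rank_one (tf_shift z \<xi>) (tf_shift z \<eta>)"
  by (simp add: op_shift_def rank_one_def fun_eq_iff tf_shift_scaleC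
      cinner_cadjoint'[OF bounded_clinear_tf_shift])

lemma compose_rank_one:
  assumes "bounded_clinear A"
  shows "A \<circ> rank_one \<xi> \<eta> = rank_one (A \<xi>) \<eta>"
  by (simp add: rank_one_def fun_eq_iff bounded_clinearD(2)[OF assms])

text \<open>The reflections built into the convolution cancel those of the arguments. With
  \<open>A\<close> = \<open>T\<close> this is the Berezin identity; with \<open>A\<close> of trace
  class it evaluates the integrand of the trace duality.\<close>

lemma op_op_conv_rank_one:
  assumes "bounded_clinear A"
  shows "op_op_conv A (rank_one (reflect \<xi>) (reflect \<eta>)) z = cinner (A (tf_shift z \<xi>)) (tf_shift z \<eta>)"
  by (simp add: op_op_conv_def op_reflect_rank_one op_shift_rank_one compose_rank_one[OF assms]
      op_trace_rank_one)

section \<open>The short-time Fourier transform\<close>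

lemma stft_add: "stft \<phi> (a + b) z = stft \<phi> a z + stft \<phi> b z"
  by (simp add: stft_def cinner_add_left)

lemma stft_scaleC: "stft \<phi> (c *\<^sub>C a) z = c * stft \<phi> a z"
  by (simp add: stft_def cinner_scaleC_left)

lemma norm_stft_le: "norm (stft \<phi> \<psi> z) \<le> norm \<psi> * norm \<phi>"
  unfolding stft_def using norm_cinner_le[of \<psi> "tf_shift z \<phi>"] by (simp add: norm_tf_shift)

lemma stft_abs:
  assumes "square_integrable f" "square_integrable h"
  shows "stft (abs_l2 h) (abs_l2 f) (x, w) = fourier (\<lambda>t. f t * cnj (h (t - x))) w"
  unfolding stft_def fourier_def
  using assms by (simp add: tf_shift_abs cinner_abs square_integrable_tf_shift cnj_wave mult_ac)

text \<open>Fixed representatives make the transform a parameter integral of a jointly measurable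
  function.\<close>

lemma borel_measurable_stft [measurable]: "stft \<phi> \<psi> \<in> borel_measurable borel"
proof -
  obtain f where f: "square_integrable f" "\<psi> = abs_l2 f" by (rule l2_cases)
  obtain h where h: "square_integrable h" "\<phi> = abs_l2 h" by (rule l2_cases)
  have [measurable]: "f \<in> borel_measurable borel" "h \<in> borel_measurable borel"
    using f h by (auto simp: square_integrable_def)
  have "stft \<phi> \<psi> = (\<lambda>z. \<integral>t. f t * cnj (h (t - fst z)) * wave (- (snd z \<bullet> t)) \<partial>lborel)"
    using f h by (auto simp: fun_eq_iff stft_abs fourier_def)
  then show ?thesis unfolding borel_prod[symmetric] by simp
qed

text \<open>One half of Moyal's identity. For fixed translation x the transform is a Fourier
  transform in the frequency, so the Fourier bound applies to each slice; Tonelli and translation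
  invariance then separate the two norms.\<close>

lemma stft_L2_le:
  "(\<integral>\<^sup>+z. ennreal ((norm (stft \<phi> \<psi> z))\<^sup>2) \<partial>lborel) \<le> ennreal ((norm \<psi> * norm \<phi>)\<^sup>2)"
proof -
  obtain f where f: "square_integrable f" "\<psi> = abs_l2 f" by (rule l2_cases)
  obtain h where h: "square_integrable h" "\<phi> = abs_l2 h" by (rule l2_cases)
  have [measurable]: "f \<in> borel_measurable borel" "h \<in> borel_measurable borel"
    using f h by (auto simp: square_integrable_def)
  have [measurable]: "stft \<phi> \<psi> \<in> borel_measurable (borel \<Otimes>\<^sub>M borel)" by (simp add: borel_prod)
  have "(\<integral>\<^sup>+z. ennreal ((norm (stft \<phi> \<psi> z))\<^sup>2) \<partial>lborel)
     = (\<integral>\<^sup>+x. \<integral>\<^sup>+w. ennreal ((norm (stft \<phi> \<psi> (x, w)))\<^sup>2) \<partial>lborel \<partial>lborel)"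
    unfolding lborel_prod[symmetric] by (rule lborel.nn_integral_fst[symmetric]) measurable
  also have "\<dots> \<le> (\<integral>\<^sup>+x. \<integral>\<^sup>+t. ennreal ((norm (f t * cnj (h (t - x))))\<^sup>2) \<partial>lborel \<partial>lborel)"
    unfolding f(2) h(2) stft_abs[OF f(1) h(1)]
    by (intro nn_integral_mono fourier_L2_le square_integrable_mult_integrable f(1)
        square_integrable_translate h(1))
  also have "\<dots> = (\<integral>\<^sup>+x. \<integral>\<^sup>+t. ennreal ((norm (f t))\<^sup>2) * ennreal ((norm (h (t - x)))\<^sup>2) \<partial>lborel \<partial>lborel)"
    by (simp add: norm_mult power_mult_distrib ennreal_mult)
  also have "\<dots> = (\<integral>\<^sup>+t. \<integral>\<^sup>+x. ennreal ((norm (f t))\<^sup>2) * ennreal ((norm (h (t - x)))\<^sup>2) \<partial>lborel \<partial>lborel)"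
    by (rule lborel_pair.Fubini') measurable
  also have "\<dots> = (\<integral>\<^sup>+t. ennreal ((norm (f t))\<^sup>2) * ennreal ((norm \<phi>)\<^sup>2) \<partial>lborel)"
    using nn_integral_lborel_translate(2)[of "\<lambda>t. ennreal ((norm (h t))\<^sup>2)"]
    by (simp add: nn_integral_cmult nn_integral_norm_abs[OF h(1)] h(2))
  also have "\<dots> = ennreal ((norm \<psi> * norm \<phi>)\<^sup>2)"
    by (simp add: nn_integral_multc nn_integral_norm_abs[OF f(1)] f(2) power_mult_distrib ennreal_mult)
  finally show ?thesis .
qed

lemma nn_integral_stft_mult_le:
  "(\<integral>\<^sup>+z. ennreal (norm (stft \<phi>\<^sub>1 \<psi> z * cnj (stft \<phi>\<^sub>2 \<phi> z))) \<partial>lborel)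
    \<le> ennreal (norm \<phi>\<^sub>1 * norm \<phi>\<^sub>2 * norm \<psi> * norm \<phi>)"
proof -
  let ?I = "\<integral>\<^sup>+z. ennreal (norm (stft \<phi>\<^sub>1 \<psi> z * cnj (stft \<phi>\<^sub>2 \<phi> z))) \<partial>lborel"
  have "?I\<^sup>2 = (\<integral>\<^sup>+z. ennreal (norm (stft \<phi>\<^sub>1 \<psi> z)) * ennreal (norm (stft \<phi>\<^sub>2 \<phi> z)) \<partial>lborel)\<^sup>2"
    by (simp add: norm_mult ennreal_mult)
  also have "\<dots> \<le> (\<integral>\<^sup>+z. (ennreal (norm (stft \<phi>\<^sub>1 \<psi> z)))\<^sup>2 \<partial>lborel) *
      (\<integral>\<^sup>+z. (ennreal (norm (stft \<phi>\<^sub>2 \<phi> z)))\<^sup>2 \<partial>lborel)"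
    by (rule Cauchy_Schwarz_nn_integral) measurable
  also have "\<dots> \<le> ennreal ((norm \<psi> * norm \<phi>\<^sub>1)\<^sup>2) * ennreal ((norm \<phi> * norm \<phi>\<^sub>2)\<^sup>2)"
    unfolding ennreal_power[OF norm_ge_zero] by (intro mult_mono stft_L2_le) auto
  also have "\<dots> = (ennreal (norm \<phi>\<^sub>1 * norm \<phi>\<^sub>2 * norm \<psi> * norm \<phi>))\<^sup>2"
    by (simp add: ennreal_power power_mult_distrib mult_ac flip: ennreal_mult)
  finally have sq: "?I\<^sup>2 \<le> (ennreal (norm \<phi>\<^sub>1 * norm \<phi>\<^sub>2 * norm \<psi> * norm \<phi>))\<^sup>2" .
  show ?thesis
  \<comment> \<open>Removing the square: a finite value is compared by real square roots, and an
    infinite one contradicts the finite bound.\<close>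
  proof (cases ?I)
    case (real a)
    then show ?thesis
      using sq by (auto simp: ennreal_power intro!: ennreal_leI power2_le_imp_le[of a])
  next
    case top
    then show ?thesis using sq by (simp add: ennreal_power top_unique)
  qed
qed

section \<open>Localization operators through their weak form\<close>

definition loc_kernel ::
  "('a::euclidean_space \<times> 'a \<Rightarrow> complex) \<Rightarrow> 'a l2 \<Rightarrow> 'a l2 \<Rightarrow> 'a l2 \<Rightarrow> 'a l2 \<Rightarrow> 'a \<times> 'a \<Rightarrow> complex" where
  "loc_kernel f \<phi>\<^sub>1 \<phi>\<^sub>2 \<psi> \<phi> z = f z * stft \<phi>\<^sub>1 \<psi> z * cnj (stft \<phi>\<^sub>2 \<phi> z)"

lemma borel_measurable_loc_kernel [measurable]:
  assumes [measurable]: "f \<in> borel_measurable borel"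
  shows "loc_kernel f \<phi>\<^sub>1 \<phi>\<^sub>2 \<psi> \<phi> \<in> borel_measurable borel"
  unfolding loc_kernel_def by measurable

lemma localization_op_eqI:
  assumes "\<And>\<phi>. has_bochner_integral lborel (loc_kernel f \<phi>\<^sub>1 \<phi>\<^sub>2 \<psi> \<phi>) (cinner \<xi> \<phi>)"
  shows "localization_op f \<phi>\<^sub>1 \<phi>\<^sub>2 \<psi> = \<xi>"
  unfolding localization_op_def loc_kernel_def[symmetric]
  using assms by (intro the_equality cinner_eqI) (blast intro: has_bochner_integral_eq)+

text \<open>Exactly what existence, boundedness and trace duality use, so that integrable and
  bounded symbols share these proofs. The extended-valued integral encodes integrability and the
  estimate in one inequality.\<close>

definition bounded_symbol ::
  "('a::euclidean_space \<times> 'a \<Rightarrow> complex) \<Rightarrow> 'a l2 \<Rightarrow> 'a l2 \<Rightarrow> real \<Rightarrow> bool" where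
  "bounded_symbol f \<phi>\<^sub>1 \<phi>\<^sub>2 K \<longleftrightarrow> 0 \<le> K \<and> f \<in> borel_measurable borel \<and>
     (\<forall>\<psi> \<phi>. (\<integral>\<^sup>+z. norm (loc_kernel f \<phi>\<^sub>1 \<phi>\<^sub>2 \<psi> \<phi> z) \<partial>lborel) \<le> ennreal (K * norm \<psi> * norm \<phi>))"

lemma bounded_symbolD:
  assumes "bounded_symbol f \<phi>\<^sub>1 \<phi>\<^sub>2 K"
  shows "integrable lborel (loc_kernel f \<phi>\<^sub>1 \<phi>\<^sub>2 \<psi> \<phi>)"
    and "(\<integral>z. norm (loc_kernel f \<phi>\<^sub>1 \<phi>\<^sub>2 \<psi> \<phi> z) \<partial>lborel) \<le> K * norm \<psi> * norm \<phi>"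
    and "norm (\<integral>z. loc_kernel f \<phi>\<^sub>1 \<phi>\<^sub>2 \<psi> \<phi> z \<partial>lborel) \<le> K * norm \<psi> * norm \<phi>"
proof -
  have [measurable]: "f \<in> borel_measurable borel" and K: "K \<ge> 0"
    and le: "(\<integral>\<^sup>+z. norm (loc_kernel f \<phi>\<^sub>1 \<phi>\<^sub>2 \<psi> \<phi> z) \<partial>lborel) \<le> ennreal (K * norm \<psi> * norm \<phi>)"
    using assms by (auto simp: bounded_symbol_def)
  show int: "integrable lborel (loc_kernel f \<phi>\<^sub>1 \<phi>\<^sub>2 \<psi> \<phi>)"
    using le by (intro integrableI_bounded) (auto simp: less_top[symmetric] top_unique)
  show le': "(\<integral>z. norm (loc_kernel f \<phi>\<^sub>1 \<phi>\<^sub>2 \<psi> \<phi> z) \<partial>lborel) \<le> K * norm \<psi> * norm \<phi>"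
    using le K by (simp add: nn_integral_eq_integral integrable_norm[OF int])
  show "norm (\<integral>z. loc_kernel f \<phi>\<^sub>1 \<phi>\<^sub>2 \<psi> \<phi> z \<partial>lborel) \<le> K * norm \<psi> * norm \<phi>"
    using integral_norm_bound le' by (rule order_trans)
qed

lemma localization_op_weak:
  assumes K: "bounded_symbol f \<phi>\<^sub>1 \<phi>\<^sub>2 K"
  shows "has_bochner_integral lborel (loc_kernel f \<phi>\<^sub>1 \<phi>\<^sub>2 \<psi> \<phi>) (cinner (localization_op f \<phi>\<^sub>1 \<phi>\<^sub>2 \<psi>) \<phi>)"
proof -
  note int = bounded_symbolD(1)[OF K]
  \<comment> \<open>The weak form is antilinear in \<phi>; conjugation makes it linear, as Riesz
    representation requires.\<close>
  define L where "L \<phi> = cnj (\<integral>z. loc_kernel f \<phi>\<^sub>1 \<phi>\<^sub>2 \<psi> \<phi> z \<partial>lborel)" for \<phi>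
  have "\<exists>\<xi>. \<forall>\<phi>. L \<phi> = cinner \<phi> \<xi>"
  proof (rule clinear_functional_repr)
    fix a b c
    have "loc_kernel f \<phi>\<^sub>1 \<phi>\<^sub>2 \<psi> (a + b) = (\<lambda>z. loc_kernel f \<phi>\<^sub>1 \<phi>\<^sub>2 \<psi> a z + loc_kernel f \<phi>\<^sub>1 \<phi>\<^sub>2 \<psi> b z)"
      by (auto simp: loc_kernel_def stft_add algebra_simps)
    then show "L (a + b) = L a + L b" by (simp add: L_def int)
    have "loc_kernel f \<phi>\<^sub>1 \<phi>\<^sub>2 \<psi> (c *\<^sub>C a) = (\<lambda>z. cnj c * loc_kernel f \<phi>\<^sub>1 \<phi>\<^sub>2 \<psi> a z)"
      by (auto simp: loc_kernel_def stft_scaleC)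
    then show "L (c *\<^sub>C a) = c * L a" by (simp add: L_def)
    show "norm (L a) \<le> (K * norm \<psi>) * norm a"
      unfolding L_def complex_mod_cnj by (rule bounded_symbolD(3)[OF K])
  qed
  then obtain \<xi> where "\<And>\<phi>. L \<phi> = cinner \<phi> \<xi>" by blast
  then have "(\<integral>z. loc_kernel f \<phi>\<^sub>1 \<phi>\<^sub>2 \<psi> \<phi> z \<partial>lborel) = cinner \<xi> \<phi>" for \<phi>
    unfolding L_def by (metis cinner_commute complex_cnj_cnj)
  then have *: "has_bochner_integral lborel (loc_kernel f \<phi>\<^sub>1 \<phi>\<^sub>2 \<psi> \<phi>) (cinner \<xi> \<phi>)" for \<phi>
    by (simp add: has_bochner_integral_iff int)
  from localization_op_eqI[OF this] * show ?thesis by simp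
qed

lemma bounded_clinear_localization_op:
  assumes K: "bounded_symbol f \<phi>\<^sub>1 \<phi>\<^sub>2 K"
  shows "bounded_clinear (localization_op f \<phi>\<^sub>1 \<phi>\<^sub>2)"
proof (rule bounded_clinearI)
  let ?B = "localization_op f \<phi>\<^sub>1 \<phi>\<^sub>2"
  note B = localization_op_weak[OF K]
  fix a b c
  have "loc_kernel f \<phi>\<^sub>1 \<phi>\<^sub>2 (a + b) \<phi> = (\<lambda>z. loc_kernel f \<phi>\<^sub>1 \<phi>\<^sub>2 a \<phi> z + loc_kernel f \<phi>\<^sub>1 \<phi>\<^sub>2 b \<phi> z)" for \<phi>
    by (auto simp: loc_kernel_def stft_add algebra_simps)
  then show "?B (a + b) = ?B a + ?B b"
    by (intro localization_op_eqI) (simp add: cinner_add_left has_bochner_integral_add B)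
  have "loc_kernel f \<phi>\<^sub>1 \<phi>\<^sub>2 (c *\<^sub>C a) \<phi> = (\<lambda>z. c * loc_kernel f \<phi>\<^sub>1 \<phi>\<^sub>2 a \<phi> z)" for \<phi>
    by (auto simp: loc_kernel_def stft_scaleC)
  then show "?B (c *\<^sub>C a) = c *\<^sub>C ?B a"
    by (intro localization_op_eqI) (simp add: cinner_scaleC_left has_bochner_integral_mult_right B)
  \<comment> \<open>Testing the weak form on the image vector itself and cancelling one factor gives
    the operator bound.\<close>
  have "norm (cinner (?B a) (?B a)) \<le> K * norm a * norm (?B a)"
    using bounded_symbolD(3)[OF K] has_bochner_integral_integral_eq[OF B] by metis
  then have "norm (?B a) * norm (?B a) \<le> (K * norm a) * norm (?B a)"
    by (simp add: cinner_self norm_power power2_eq_square norm_mult)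
  then show "norm (?B a) \<le> K * norm a"
    using K by (cases "norm (?B a) = 0") (auto simp: bounded_symbol_def)
qed

text \<open>The symbol supplies the integrability; both transforms are bounded pointwise by
  norms.\<close>

lemma bounded_symbol_L1:
  assumes f: "Lp_function 1 f"
  shows "\<exists>K. bounded_symbol f \<phi>\<^sub>1 \<phi>\<^sub>2 K"
proof
  have [measurable]: "f \<in> borel_measurable borel" and int: "integrable lborel (\<lambda>z. norm (f z))"
    using f by (auto simp: Lp_function_def)
  define M where "M = (\<integral>z. norm (f z) \<partial>lborel)"
  have M: "M \<ge> 0" "(\<integral>\<^sup>+z. norm (f z) \<partial>lborel) = ennreal M"
    using int by (auto simp: M_def nn_integral_eq_integral)
  have "(\<integral>\<^sup>+z. norm (loc_kernel f \<phi>\<^sub>1 \<phi>\<^sub>2 \<psi> \<phi> z) \<partial>lborel)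
    \<le> ennreal ((M * norm \<phi>\<^sub>1 * norm \<phi>\<^sub>2) * norm \<psi> * norm \<phi>)" for \<psi> \<phi>
  proof -
    have "(\<integral>\<^sup>+z. norm (loc_kernel f \<phi>\<^sub>1 \<phi>\<^sub>2 \<psi> \<phi> z) \<partial>lborel)
       \<le> (\<integral>\<^sup>+z. ennreal (norm (f z)) * ennreal ((norm \<psi> * norm \<phi>\<^sub>1) * (norm \<phi> * norm \<phi>\<^sub>2)) \<partial>lborel)"
    proof (rule nn_integral_mono)
      fix z
      have "norm (f z) * (norm (stft \<phi>\<^sub>1 \<psi> z) * norm (stft \<phi>\<^sub>2 \<phi> z))
        \<le> norm (f z) * ((norm \<psi> * norm \<phi>\<^sub>1) * (norm \<phi> * norm \<phi>\<^sub>2))"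
        by (intro mult_left_mono mult_mono norm_stft_le) auto
      then show "ennreal (norm (loc_kernel f \<phi>\<^sub>1 \<phi>\<^sub>2 \<psi> \<phi> z)) \<le>
          ennreal (norm (f z)) * ennreal ((norm \<psi> * norm \<phi>\<^sub>1) * (norm \<phi> * norm \<phi>\<^sub>2))"
        by (simp add: loc_kernel_def norm_mult ennreal_leI mult.assoc flip: ennreal_mult)
    qed
    also have "\<dots> = ennreal ((M * norm \<phi>\<^sub>1 * norm \<phi>\<^sub>2) * norm \<psi> * norm \<phi>)"
      using M by (subst nn_integral_multc) (auto simp: mult_ac simp flip: ennreal_mult)
    finally show ?thesis .
  qed
  then show "bounded_symbol f \<phi>\<^sub>1 \<phi>\<^sub>2 (M * norm \<phi>\<^sub>1 * norm \<phi>\<^sub>2)"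
    using M by (simp add: bounded_symbol_def)
qed

text \<open>The symbol is only a bounded factor, so integrability comes from the two transforms,
  through their L2 bounds and Cauchy-Schwarz.\<close>

lemma bounded_symbol_Linf:
  assumes f: "Lp_function \<infinity> f"
  shows "\<exists>K. bounded_symbol f \<phi>\<^sub>1 \<phi>\<^sub>2 K"
proof -
  obtain C where [measurable]: "f \<in> borel_measurable borel" and C': "AE z in lborel. norm (f z) \<le> C"
    using f by (auto simp: Lp_function_def)
  \<comment> \<open>The maximum provides nonnegativity without an argument that an essential bound
    of a norm cannot be negative.\<close>
  define M where "M = max C 0"
  have M: "M \<ge> 0" "AE z in lborel. norm (f z) \<le> M"
    using C' by (auto simp: M_def elim: eventually_mono)
  have "(\<integral>\<^sup>+z. norm (loc_kernel f \<phi>\<^sub>1 \<phi>\<^sub>2 \<psi> \<phi> z) \<partial>lborel)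
    \<le> ennreal ((M * norm \<phi>\<^sub>1 * norm \<phi>\<^sub>2) * norm \<psi> * norm \<phi>)" for \<psi> \<phi>
  proof -
    have "(\<integral>\<^sup>+z. norm (loc_kernel f \<phi>\<^sub>1 \<phi>\<^sub>2 \<psi> \<phi> z) \<partial>lborel)
       \<le> (\<integral>\<^sup>+z. ennreal M * ennreal (norm (stft \<phi>\<^sub>1 \<psi> z * cnj (stft \<phi>\<^sub>2 \<phi> z))) \<partial>lborel)"
    proof (rule nn_integral_mono_AE, use M(2) in eventually_elim)
      case (elim z)
      then have "norm (f z) * norm (stft \<phi>\<^sub>1 \<psi> z * cnj (stft \<phi>\<^sub>2 \<phi> z))
        \<le> M * norm (stft \<phi>\<^sub>1 \<psi> z * cnj (stft \<phi>\<^sub>2 \<phi> z))"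
        by (intro mult_right_mono) auto
      then show ?case
        using M(1) by (simp add: loc_kernel_def norm_mult ennreal_leI mult.assoc flip: ennreal_mult)
    qed
    also have "\<dots> \<le> ennreal M * ennreal (norm \<phi>\<^sub>1 * norm \<phi>\<^sub>2 * norm \<psi> * norm \<phi>)"
      by (subst nn_integral_cmult) (auto intro!: mult_left_mono nn_integral_stft_mult_le)
    also have "\<dots> = ennreal ((M * norm \<phi>\<^sub>1 * norm \<phi>\<^sub>2) * norm \<psi> * norm \<phi>)"
      using M by (simp add: mult_ac flip: ennreal_mult)
    finally show ?thesis .
  qed
  then have "bounded_symbol f \<phi>\<^sub>1 \<phi>\<^sub>2 (M * norm \<phi>\<^sub>1 * norm \<phi>\<^sub>2)"
    using M by (simp add: bounded_symbol_def)
  then show ?thesis ..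
qed

text \<open>The integrands in the two definite descriptions agree pointwise, so the descriptions
  themselves coincide.\<close>

lemma fun_op_conv_L1_rank_one: "fun_op_conv_L1 g (rank_one \<phi>\<^sub>2 \<phi>\<^sub>1) = localization_op g \<phi>\<^sub>1 \<phi>\<^sub>2"
proof -
  have "cinner (g z *\<^sub>C op_shift z (rank_one \<phi>\<^sub>2 \<phi>\<^sub>1) \<psi>) \<phi> = g z * stft \<phi>\<^sub>1 \<psi> z * cnj (stft \<phi>\<^sub>2 \<phi> z)" for z \<psi> \<phi>
    unfolding op_shift_rank_one
    by (simp add: rank_one_def cinner_scaleC_left stft_def flip: cinner_commute)
  then show ?thesis
    by (simp add: fun_op_conv_L1_def localization_op_def fun_eq_iff)
qed


section \<open>Trace duality\<close>

lemma has_sum_imp_sums_indicator: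
  fixes f :: "nat \<Rightarrow> 'a::{comm_monoid_add, topological_space}"
  assumes "(f has_sum a) N"
  shows "(\<lambda>n. if n \<in> N then f n else 0) sums a"
proof -
  have "((\<lambda>n. if n \<in> N then f n else 0) has_sum a) UNIV"
    using assms by (subst has_sum_cong_neutral[where T=N and g=f]) auto
  then show ?thesis by (rule has_sum_imp_sums)
qed

lemma trace_class_duality:
  assumes K: "bounded_symbol f \<phi>\<^sub>1 \<phi>\<^sub>2 K" and R: "trace_class R"
  shows "has_bochner_integral lborel (\<lambda>z. f z * cnj (cinner (R (tf_shift z \<phi>\<^sub>1)) (tf_shift z \<phi>\<^sub>2)))
    (op_trace (localization_op f \<phi>\<^sub>1 \<phi>\<^sub>2 \<circ> cadjoint R))"
proof -
  let ?B = "localization_op f \<phi>\<^sub>1 \<phi>\<^sub>2"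
  from R obtain N :: "nat set" and s \<xi> \<eta> where Rb: "bounded_clinear R"
    and s: "\<forall>n\<in>N. 0 < s n" "s summable_on N"
    and on: "orthonormal_family N \<xi>" "orthonormal_family N \<eta>"
    and sum: "\<forall>\<psi>. ((\<lambda>n. complex_of_real (s n) *\<^sub>C rank_one (\<xi> n) (\<eta> n) \<psi>) has_sum R \<psi>) N"
    unfolding trace_class_def by blast
  \<comment> \<open>Extension by zero off \<open>N\<close> turns the unordered sum into a series
    over all naturals, the setting of termwise integration.\<close>
  define F where "F n z = (if n \<in> N then of_real (s n) * loc_kernel f \<phi>\<^sub>1 \<phi>\<^sub>2 (\<eta> n) (\<xi> n) z else 0)" for n z
  have [measurable]: "f \<in> borel_measurable borel" and K0: "K \<ge> 0" using K by (auto simp: bounded_symbol_def)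
  have Fint: "integrable lborel (F n)" for n
    using bounded_symbolD(1)[OF K] by (cases "n \<in> N") (auto simp: F_def[abs_def])
  have s_summable: "summable (\<lambda>n. (if n \<in> N then s n else 0) * c)" for c
    using has_sum_imp_sums_indicator[where f=s and N=N] s(2)
    by (intro summable_mult2) (auto simp: summable_on_def summable_def)
  have F_sums: "(\<lambda>n. F n z) sums (f z * cnj (cinner (R (tf_shift z \<phi>\<^sub>1)) (tf_shift z \<phi>\<^sub>2)))" for z
  proof -
    have "((\<lambda>n. f z * cnj (of_real (s n) * (cinner (tf_shift z \<phi>\<^sub>1) (\<eta> n) * cinner (\<xi> n) (tf_shift z \<phi>\<^sub>2))))
      has_sum f z * cnj (cinner (R (tf_shift z \<phi>\<^sub>1)) (tf_shift z \<phi>\<^sub>2))) N"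
      by (intro has_sum_cmult_right) (simp only: has_sum_cnj_iff trace_class_cinner_expansion[OF sum])
    \<comment> \<open>Conjugation turns the term into a kernel with \<eta> in the first and \<xi> in
      the second argument, opposite to their order in the expansion of \<open>R\<close>.\<close>
    moreover have "f z * cnj (of_real (s n) * (cinner (tf_shift z \<phi>\<^sub>1) (\<eta> n) * cinner (\<xi> n) (tf_shift z \<phi>\<^sub>2)))
      = of_real (s n) * loc_kernel f \<phi>\<^sub>1 \<phi>\<^sub>2 (\<eta> n) (\<xi> n) z" for n
      by (simp add: loc_kernel_def stft_def cinner_commute[of "tf_shift z \<phi>\<^sub>1" "\<eta> n"])
    ultimately show ?thesis
      unfolding F_def by (intro has_sum_imp_sums_indicator) (simp only:)
  qed
  \<comment> \<open>The singular vectors are unit vectors, so both transforms are bounded by the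
    window norms and \<open>s\<close> carries the convergence.\<close>
  have pointwise: "summable (\<lambda>n. norm (F n z))" for z
  proof (rule summable_comparison_test')
    show "summable (\<lambda>n. (if n \<in> N then s n else 0) * (norm (f z) * (norm \<phi>\<^sub>1 * norm \<phi>\<^sub>2)))" by (rule s_summable)
    fix n
    show "norm (norm (F n z)) \<le> (if n \<in> N then s n else 0) * (norm (f z) * (norm \<phi>\<^sub>1 * norm \<phi>\<^sub>2))"
    proof (cases "n \<in> N")
      case True
      have "norm (stft \<phi>\<^sub>1 (\<eta> n) z) \<le> norm \<phi>\<^sub>1" "norm (stft \<phi>\<^sub>2 (\<xi> n) z) \<le> norm \<phi>\<^sub>2"
        using norm_stft_le[of \<phi>\<^sub>1 "\<eta> n" z] norm_stft_le[of \<phi>\<^sub>2 "\<xi> n" z]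
          norm_orthonormal[OF on(1) True] norm_orthonormal[OF on(2) True] by auto
      then have "s n * (norm (f z) * (norm (stft \<phi>\<^sub>1 (\<eta> n) z) * norm (stft \<phi>\<^sub>2 (\<xi> n) z)))
        \<le> s n * (norm (f z) * (norm \<phi>\<^sub>1 * norm \<phi>\<^sub>2))"
        using s(1) True by (intro mult_left_mono mult_mono) (auto intro: less_imp_le)
      moreover have "norm (norm (F n z)) = s n * (norm (f z) * (norm (stft \<phi>\<^sub>1 (\<eta> n) z) * norm (stft \<phi>\<^sub>2 (\<xi> n) z)))"
        using bspec[OF s(1) True] True by (simp add: F_def loc_kernel_def norm_mult)
      ultimately show ?thesis by (simp only: True if_True)
    qed (simp add: F_def)
  qed
  \<comment> \<open>For unit vectors \<open>K\<close> bounds the integrals of all kernels at once,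
    so these are dominated by a multiple of \<open>s\<close>.\<close>
  have norms: "summable (\<lambda>n. \<integral>z. norm (F n z) \<partial>lborel)"
  proof (rule summable_comparison_test')
    show "summable (\<lambda>n. (if n \<in> N then s n else 0) * K)" by (rule s_summable)
    fix n
    show "norm (\<integral>z. norm (F n z) \<partial>lborel) \<le> (if n \<in> N then s n else 0) * K"
    proof (cases "n \<in> N")
      case True
      have "(\<integral>z. norm (loc_kernel f \<phi>\<^sub>1 \<phi>\<^sub>2 (\<eta> n) (\<xi> n) z) \<partial>lborel) \<le> K"
        using bounded_symbolD(2)[OF K, of "\<eta> n" "\<xi> n"]
          norm_orthonormal[OF on(1) True] norm_orthonormal[OF on(2) True] by simp
      then show ?thesis using True bspec[OF s(1) True]
        by (simp add: F_def norm_mult abs_mult)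
    qed (simp add: F_def)
  qed
  have int_F: "integral\<^sup>L lborel (F n) = (if n \<in> N then of_real (s n) * cinner (?B (\<eta> n)) (\<xi> n) else 0)" for n
    using has_bochner_integral_integral_eq[OF localization_op_weak[OF K, of "\<eta> n" "\<xi> n"]]
    by (simp add: F_def[abs_def])
  have "(\<lambda>n. integral\<^sup>L lborel (F n)) sums op_trace (?B \<circ> cadjoint R)"
    unfolding int_F
    by (intro has_sum_imp_sums_indicator
        op_trace_compose_cadjoint[OF bounded_clinear_localization_op[OF K] Rb s on sum])
  moreover have "(\<lambda>n. integral\<^sup>L lborel (F n)) sums (\<integral>z. (\<Sum>n. F n z) \<partial>lborel)"
    using Fint pointwise norms by (intro sums_integral) auto
  moreover have "integrable lborel (\<lambda>z. \<Sum>n. F n z)"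
    using Fint pointwise norms by (intro integrable_suminf) auto
  moreover have "(\<Sum>n. F n z) = f z * cnj (cinner (R (tf_shift z \<phi>\<^sub>1)) (tf_shift z \<phi>\<^sub>2))" for z
    using F_sums sums_unique by metis
  ultimately show ?thesis
    by (simp add: has_bochner_integral_iff sums_unique2)
qed

text \<open>Existence is the trace duality. For uniqueness take \<open>R\<close> =
  \<open>rank_one \<phi> \<psi>\<close>: the trace of \<open>B \<circ> cadjoint R\<close> is then
  \<open>cinner (B \<psi>) \<phi>\<close>, so the duality determines all matrix entries of
  \<open>B\<close>.\<close>

lemma fun_op_conv_Linf_rank_one:
  fixes \<phi>\<^sub>1 \<phi>\<^sub>2 :: "'a::euclidean_space l2"
  assumes "Lp_function \<infinity> h"
  shows "fun_op_conv_Linf h (rank_one \<phi>\<^sub>2 \<phi>\<^sub>1) = localization_op h \<phi>\<^sub>1 \<phi>\<^sub>2"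
proof -
  obtain K where K: "bounded_symbol h \<phi>\<^sub>1 \<phi>\<^sub>2 K" using bounded_symbol_Linf[OF assms] by blast
  have conv: "op_op_conv R (cadjoint (op_reflect (rank_one \<phi>\<^sub>2 \<phi>\<^sub>1))) z
      = cinner (R (tf_shift z \<phi>\<^sub>1)) (tf_shift z \<phi>\<^sub>2)" if "trace_class R" for R z
    using that unfolding trace_class_def op_reflect_rank_one cadjoint_rank_one
    by (intro op_op_conv_rank_one) blast
  show ?thesis
    unfolding fun_op_conv_Linf_def
  proof (rule the_equality, intro conjI allI impI)
    show "bounded_clinear (localization_op h \<phi>\<^sub>1 \<phi>\<^sub>2)" by (rule bounded_clinear_localization_op[OF K])
    fix R :: "'a l2 \<Rightarrow> 'a l2" assume R: "trace_class R"
    show "has_bochner_integral lborel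
        (\<lambda>z. h z * cnj (op_op_conv R (cadjoint (op_reflect (rank_one \<phi>\<^sub>2 \<phi>\<^sub>1))) z))
        (op_trace (localization_op h \<phi>\<^sub>1 \<phi>\<^sub>2 \<circ> cadjoint R))"
      unfolding conv[OF R] by (rule trace_class_duality[OF K R])
  next
    fix B :: "'a l2 \<Rightarrow> 'a l2"
    assume B: "bounded_clinear B \<and> (\<forall>R. trace_class R \<longrightarrow> has_bochner_integral lborel
        (\<lambda>z. h z * cnj (op_op_conv R (cadjoint (op_reflect (rank_one \<phi>\<^sub>2 \<phi>\<^sub>1))) z)) (op_trace (B \<circ> cadjoint R)))"
    show "B = localization_op h \<phi>\<^sub>1 \<phi>\<^sub>2"
    proof (rule ext, rule cinner_eqI)
      fix \<psi> \<phi> :: "'a l2"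
      have "cinner (A \<psi>) \<phi> = op_trace (A \<circ> cadjoint (rank_one \<phi> \<psi>))" if "bounded_clinear A" for A :: "'a l2 \<Rightarrow> 'a l2"
        using that by (simp add: cadjoint_rank_one compose_rank_one op_trace_rank_one)
      moreover have "op_trace (B \<circ> cadjoint (rank_one \<phi> \<psi>))
          = op_trace (localization_op h \<phi>\<^sub>1 \<phi>\<^sub>2 \<circ> cadjoint (rank_one \<phi> \<psi>))"
        using B trace_class_duality[OF K trace_class_rank_one[of \<phi> \<psi>]] trace_class_rank_one[of \<phi> \<psi>]
        by (metis (no_types, lifting) conv has_bochner_integral_cong has_bochner_integral_eq)
      ultimately show "cinner (B \<psi>) \<phi> = cinner (localization_op h \<phi>\<^sub>1 \<phi>\<^sub>2 \<psi>) \<phi>"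
        using B bounded_clinear_localization_op[OF K] by simp
    qed
  qed
qed

section \<open>Symbols with a general exponent\<close>

text \<open>Cut at height 1: where |f| > 1 it is at most |f|^q because q is at least 1, hence
  integrable there; elsewhere it is bounded by 1. An infinite exponent is treated apart, since the
  definition then speaks of an essential bound.\<close>

lemma Lp_function_decompose:
  assumes "1 \<le> p" and f: "Lp_function p f"
  shows "\<exists>g h. Lp_function 1 g \<and> Lp_function \<infinity> h \<and> (AE z in lborel. f z = g z + h z)"
proof (cases "p = \<infinity>")
  case True
  then have "Lp_function 1 (\<lambda>z. 0) \<and> Lp_function \<infinity> f \<and> (AE z in lborel. f z = 0 + f z)"
    using f by (simp add: Lp_function_def)
  then show ?thesis by (intro exI)
next
  case False
  define q where "q = enn2real p"
  have [measurable]: "f \<in> borel_measurable borel" and int: "integrable lborel (\<lambda>z. norm (f z) powr q)"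
    using f False by (auto simp: Lp_function_def q_def)
  have q: "1 \<le> q" using assms(1) False unfolding q_def
    by (cases p) (auto simp: top_unique)
  define g where "g z = (if norm (f z) > 1 then f z else 0)" for z
  define h where "h z = (if norm (f z) > 1 then 0 else f z)" for z
  have [measurable]: "g \<in> borel_measurable borel" "h \<in> borel_measurable borel"
    unfolding g_def h_def by measurable
  have "norm (g z) \<le> norm (f z) powr q" for z
    using powr_mono[OF q, of "norm (f z)"] by (auto simp: g_def)
  then have "integrable lborel (\<lambda>z. norm (g z))"
    by (intro Bochner_Integration.integrable_bound[OF int]) auto
  then have "Lp_function 1 g" by (simp add: Lp_function_def)
  moreover have "Lp_function \<infinity> h"
    by (auto simp: Lp_function_def h_def intro!: exI[of _ 1])
  moreover have "f z = g z + h z" for z by (simp add: g_def h_def)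
  ultimately show ?thesis by blast
qed

text \<open>Whatever the splitting, the two parts are the localization operators of g and h, and
  these add up to the one of f by linearity of the weak form in the symbol. This gives independence
  of the splitting, and it also yields the existence of the operator with symbol f.\<close>

lemma fun_op_conv_rank_one:
  assumes "1 \<le> p" and f: "Lp_function p f"
  shows "fun_op_conv f (rank_one \<phi>\<^sub>2 \<phi>\<^sub>1) = localization_op f \<phi>\<^sub>1 \<phi>\<^sub>2"
proof -
  have [measurable]: "f \<in> borel_measurable borel" using f by (simp add: Lp_function_def)
  have split: "(\<lambda>\<psi>. fun_op_conv_L1 g (rank_one \<phi>\<^sub>2 \<phi>\<^sub>1) \<psi> + fun_op_conv_Linf h (rank_one \<phi>\<^sub>2 \<phi>\<^sub>1) \<psi>)
      = localization_op f \<phi>\<^sub>1 \<phi>\<^sub>2"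
    if g: "Lp_function 1 g" and h: "Lp_function \<infinity> h" and ae: "AE z in lborel. f z = g z + h z" for g h
  proof
    fix \<psi>
    have [measurable]: "g \<in> borel_measurable borel" "h \<in> borel_measurable borel"
      using g h by (auto simp: Lp_function_def)
    obtain K K' where K: "bounded_symbol g \<phi>\<^sub>1 \<phi>\<^sub>2 K" and K': "bounded_symbol h \<phi>\<^sub>1 \<phi>\<^sub>2 K'"
      using bounded_symbol_L1[OF g, of \<phi>\<^sub>1 \<phi>\<^sub>2] bounded_symbol_Linf[OF h, of \<phi>\<^sub>1 \<phi>\<^sub>2] by blast
    have "localization_op f \<phi>\<^sub>1 \<phi>\<^sub>2 \<psi> = localization_op g \<phi>\<^sub>1 \<phi>\<^sub>2 \<psi> + localization_op h \<phi>\<^sub>1 \<phi>\<^sub>2 \<psi>"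
    proof (rule localization_op_eqI)
      fix \<phi>
      have "has_bochner_integral lborel (\<lambda>z. loc_kernel g \<phi>\<^sub>1 \<phi>\<^sub>2 \<psi> \<phi> z + loc_kernel h \<phi>\<^sub>1 \<phi>\<^sub>2 \<psi> \<phi> z)
         (cinner (localization_op g \<phi>\<^sub>1 \<phi>\<^sub>2 \<psi> + localization_op h \<phi>\<^sub>1 \<phi>\<^sub>2 \<psi>) \<phi>)"
        unfolding cinner_add_left by (intro has_bochner_integral_add localization_op_weak[OF K] localization_op_weak[OF K'])
      moreover have "AE z in lborel. loc_kernel f \<phi>\<^sub>1 \<phi>\<^sub>2 \<psi> \<phi> z = loc_kernel g \<phi>\<^sub>1 \<phi>\<^sub>2 \<psi> \<phi> z + loc_kernel h \<phi>\<^sub>1 \<phi>\<^sub>2 \<psi> \<phi> z"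
        using ae by eventually_elim (simp add: loc_kernel_def algebra_simps)
      ultimately show "has_bochner_integral lborel (loc_kernel f \<phi>\<^sub>1 \<phi>\<^sub>2 \<psi> \<phi>)
         (cinner (localization_op g \<phi>\<^sub>1 \<phi>\<^sub>2 \<psi> + localization_op h \<phi>\<^sub>1 \<phi>\<^sub>2 \<psi>) \<phi>)"
        by (subst has_bochner_integral_cong_AE) auto
    qed
    then show "fun_op_conv_L1 g (rank_one \<phi>\<^sub>2 \<phi>\<^sub>1) \<psi> + fun_op_conv_Linf h (rank_one \<phi>\<^sub>2 \<phi>\<^sub>1) \<psi>
      = localization_op f \<phi>\<^sub>1 \<phi>\<^sub>2 \<psi>"
      by (simp add: fun_op_conv_L1_rank_one fun_op_conv_Linf_rank_one[OF h])
  qed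
  show ?thesis
    unfolding fun_op_conv_def
  proof (rule the_equality)
    obtain g h where gh: "Lp_function 1 g" "Lp_function \<infinity> h" "AE z in lborel. f z = g z + h z"
      using Lp_function_decompose[OF assms] by blast
    then show "\<exists>g h. Lp_function 1 g \<and> Lp_function \<infinity> h \<and> (AE z in lborel. f z = g z + h z) \<and>
        localization_op f \<phi>\<^sub>1 \<phi>\<^sub>2
          = (\<lambda>\<psi>. fun_op_conv_L1 g (rank_one \<phi>\<^sub>2 \<phi>\<^sub>1) \<psi> + fun_op_conv_Linf h (rank_one \<phi>\<^sub>2 \<phi>\<^sub>1) \<psi>)"
      using split[OF gh] by metis
  qed (use split in blast)
qed

theorem theorem5p1:
  fixes \<phi>\<^sub>1 \<phi>\<^sub>2 :: "(real ^ 'd) l2"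
    and T :: "(real ^ 'd) l2 \<Rightarrow> (real ^ 'd) l2"
    and f :: "(real ^ 'd) \<times> (real ^ 'd) \<Rightarrow> complex"
    and p :: ennreal
  assumes "bounded_clinear T"
    and "1 \<le> p"
    and "Lp_function p f"
  shows "localization_op f \<phi>\<^sub>1 \<phi>\<^sub>2 = fun_op_conv f (rank_one \<phi>\<^sub>2 \<phi>\<^sub>1) \<and>
    (\<forall>z. berezin \<phi>\<^sub>1 \<phi>\<^sub>2 T z = op_op_conv T (rank_one (reflect \<phi>\<^sub>1) (reflect \<phi>\<^sub>2)) z)"
  by (simp add: fun_op_conv_rank_one[OF assms(2,3)] berezin_def op_op_conv_rank_one[OF assms(1)])

end
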